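(* Fix $q\in(0,1)$ and put $s=1-q$. For a positive-integer-valued, almost surely finite random variable $T_0$ with probability generating function $g$, let $T$ be the completion time under memoryless catastrophe with rate $q$, let $p=g(s)$, $D_1=g'(s)$, $W=T/E[T]$, and \[ \alpha=\frac{s(p-qD_1)}{1-p},\qquad \beta=\frac{1-qp-qsD_1}{1-p}. \] Then $1+\alpha-\beta=0$ identically. Moreover there exist $p_0,\epsilon_0>0$ depending only on $q$ such that, whenever $p\le p_0$ and $\theta>0$ satisfies $\theta pq/(1-p)\le\epsilon_0$, \[ E[e^{-\theta W}]-\frac1{1+\theta}=\frac{\alpha\,\theta^2}{(1+\theta)^2}+O\!\left(\frac{|\alpha|^2\theta^3}{(1+\theta)^3}\right)+O\!\left(\frac{p\,\theta^2}{1+\theta}\right), \] with implicit constants depending only on $q$. In particular, $T/E[T]$ converges in distribution to the exponential distribution of mean $1$ as $p\to0$ (i.e. along any family of base times $T_0$ with $p=g(s)\to0$, $q$ fixed).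
   Context: The probability generating function of $T_0$ is $g(z)=E[z^{T_0}]$. Memoryless catastrophe with rate $q$: at each step, independently of everything else, a catastrophe occurs with probability $q$; if it occurs before the base task has completed, all progress is destroyed and the process restarts from scratch with a fresh independent copy of $T_0$; the process terminates at the first step at which no catastrophe occurs and the base task completes. Formally, attempts $i=1,2,\dots$ are independent; attempt $i$ has a copy $T_0^{(i)}$ of $T_0$ and an independent $\tau_i$ with $P(\tau_i>t)=s^t$, $t=0,1,2,\dots$; it succeeds iff $T_0^{(i)}<\tau_i$, and lasts $\min(T_0^{(i)},\tau_i)$ steps. $T$ is the total length of all attempts up to and including the first successful one. The success probability of an attempt is $p=g(s)$, and $E[T]=(1-p)/(qp)$. *)

theory Defs
  imports "HOL-Probability.Probability"
begin

text \<open>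
  A base time \<open>T\<^sub>0\<close> enters only through its law, a probability mass function on the natural
  numbers (hence almost surely finite) that does not charge \<open>0\<close>.
\<close>

definition base_time :: "nat pmf \<Rightarrow> bool" where
  "base_time D \<longleftrightarrow> 0 \<notin> set_pmf D"

definition pgf :: "nat pmf \<Rightarrow> real \<Rightarrow> real" where
  "pgf D z = measure_pmf.expectation D (\<lambda>n. z ^ n)"

text \<open>
  The library's \<open>geometric_pmf q\<close> counts the failures before the first success, so it is
  shifted by one; \<open>catastrophe_pmf_tail\<close> below is the tail \<open>P(\<tau> > t) = s\<^sup>t\<close>.
\<close>

definition catastrophe_pmf :: "real \<Rightarrow> nat pmf" where
  "catastrophe_pmf q = map_pmf Suc (geometric_pmf q)"

text \<open>
  The sample space of the i.i.d. attempts: \<open>\<omega> i\<close> is the pair of the base time and the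
  catastrophe time of attempt \<open>i\<close>, numbered from \<open>0\<close>.  The lemma \<open>distr_attempts\<close> shows that
  attempts realised on any other probability space have the same joint law.
\<close>

definition attempts :: "real \<Rightarrow> nat pmf \<Rightarrow> (nat \<Rightarrow> nat \<times> nat) measure" where
  "attempts q D = (\<Pi>\<^sub>M i\<in>UNIV. measure_pmf (pair_pmf D (catastrophe_pmf q)))"

definition attempt_succeeds :: "nat \<times> nat \<Rightarrow> bool" where
  "attempt_succeeds a \<longleftrightarrow> fst a < snd a"

definition attempt_length :: "nat \<times> nat \<Rightarrow> nat" where
  "attempt_length a = min (fst a) (snd a)"

text \<open>
  On the event that no attempt succeeds, which is null for \<open>0 < q < 1\<close>, the \<open>LEAST\<close> and hence the
  value of the completion time is unspecified.
\<close>

definition completion_time :: "(nat \<Rightarrow> nat \<times> nat) \<Rightarrow> nat" where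
  "completion_time \<omega> = (\<Sum>i\<le>(LEAST i. attempt_succeeds (\<omega> i)). attempt_length (\<omega> i))"

definition mean_completion_time :: "real \<Rightarrow> nat pmf \<Rightarrow> real" where
  "mean_completion_time q D = (LINT \<omega>|attempts q D. real (completion_time \<omega>))"

definition W :: "real \<Rightarrow> nat pmf \<Rightarrow> (nat \<Rightarrow> nat \<times> nat) \<Rightarrow> real" where
  "W q D \<omega> = real (completion_time \<omega>) / mean_completion_time q D"

definition success_prob :: "real \<Rightarrow> nat pmf \<Rightarrow> real" where
  "success_prob q D = pgf D (1 - q)"

definition alpha :: "real \<Rightarrow> nat pmf \<Rightarrow> real" where
  "alpha q D = (let s = 1 - q; p = pgf D s; D1 = deriv (pgf D) s
                in s * (p - q * D1) / (1 - p))"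

definition beta :: "real \<Rightarrow> nat pmf \<Rightarrow> real" where
  "beta q D = (let s = 1 - q; p = pgf D s; D1 = deriv (pgf D) s
               in (1 - q * p - q * s * D1) / (1 - p))"

text \<open>
  Convergence in distribution along an arbitrary filter; the library's \<open>weak_conv_m\<close> is the
  case of sequences.
\<close>

definition weak_conv_along :: "('i \<Rightarrow> real measure) \<Rightarrow> real measure \<Rightarrow> 'i filter \<Rightarrow> bool" where
  "weak_conv_along \<mu> \<nu> F \<longleftrightarrow>
     (\<forall>x. isCont (cdf \<nu>) x \<longrightarrow> ((\<lambda>i. cdf (\<mu> i) x) \<longlongrightarrow> cdf \<nu> x) F)"

lemma weak_conv_along_sequentially: "weak_conv_along \<mu> \<nu> sequentially \<longleftrightarrow> weak_conv_m \<mu> \<nu>"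
  by (simp add: weak_conv_along_def weak_conv_m_def weak_conv_def)

lemma catastrophe_pmf_tail:
  assumes "0 < q" "q < 1"
  shows "measure_pmf.prob (catastrophe_pmf q) {t<..} = (1 - q) ^ t"
proof -
  have "measure_pmf.prob (catastrophe_pmf q) {..t} = measure_pmf.prob (geometric_pmf q) {..<t}"
    by (auto simp: catastrophe_pmf_def vimage_def less_eq_Suc_le intro!: arg_cong2[where f = measure])
  also have "\<dots> = (\<Sum>k<t. (1 - q) ^ k * q)"
    using assms by (subst measure_measure_pmf_finite) auto
  also have "\<dots> = 1 - (1 - q) ^ t"
    using assms by (simp add: sum_distrib_right[symmetric] sum_gp_strict)
  finally have "measure_pmf.prob (catastrophe_pmf q) {..t} = 1 - (1 - q) ^ t" .
  moreover have "UNIV - {..t} = {t<..}" by auto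
  ultimately show ?thesis
    using measure_pmf.prob_compl[of "{..t}" "catastrophe_pmf q"] by simp
qed

lemma (in prob_space) distr_attempts:
  fixes T0 \<tau> :: "nat \<Rightarrow> 'a \<Rightarrow> nat"
  assumes q: "0 < q" "q < 1"
    and attempts_indep: "indep_vars (\<lambda>_. count_space UNIV) (\<lambda>i \<omega>. (T0 i \<omega>, \<tau> i \<omega>)) UNIV"
    and indep: "\<And>i. indep_var (count_space UNIV) (T0 i) (count_space UNIV) (\<tau> i)"
    and T0: "\<And>i. distr M (count_space UNIV) (T0 i) = measure_pmf D"
    and tail: "\<And>i t. prob {\<omega>\<in>space M. \<tau> i \<omega> > t} = (1 - q) ^ t"
  shows "distr M (\<Pi>\<^sub>M i\<in>UNIV. count_space UNIV) (\<lambda>\<omega> i. (T0 i \<omega>, \<tau> i \<omega>)) = attempts q D"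
proof -
  have [measurable]: "T0 i \<in> measurable M (count_space UNIV)"
       "\<tau> i \<in> measurable M (count_space UNIV)" for i
    using indep[of i] by (auto dest: indep_var_rv1 indep_var_rv2)
  have \<tau>: "distr M (count_space UNIV) (\<tau> i) = measure_pmf (catastrophe_pmf q)" for i
  proof -
    interpret N: prob_space "distr M (count_space UNIV) (\<tau> i)"
      by (rule prob_space_distr) simp
    have N: "measure (distr M (count_space UNIV) (\<tau> i)) {t<..} = (1 - q) ^ t" for t
      using tail[of t i] by (simp add: measure_distr vimage_def Int_def conj_commute)
    have single: "measure K {n} = (if n = 0 then 1 - measure K {0<..}
        else measure K {n - 1<..} - measure K {n<..})"
      if K: "prob_space K" "sets K = UNIV" for K :: "nat measure" and n
    proof -
      interpret K: prob_space K by fact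
      have sp: "space K = UNIV" using K(2) sets_eq_imp_space_eq[of K "count_space UNIV"] by simp
      show ?thesis
      proof (cases n)
        case 0
        have "UNIV - {0::nat<..} = {0}" by auto
        with K.prob_compl[of "{0<..}"] show ?thesis using 0 K(2) sp by simp
      next
        case (Suc m)
        have "{m<..} - {Suc m<..} = {Suc m}" by auto
        with K.finite_measure_Diff[of "{m<..}" "{Suc m<..}"] show ?thesis
          using Suc K(2) by (auto simp: subset_eq)
      qed
    qed
    show ?thesis
    proof (rule measure_eqI_countable[where A = UNIV])
      fix n :: nat
      have "measure (distr M (count_space UNIV) (\<tau> i)) {n} = measure (catastrophe_pmf q) {n}"
        by (subst (1 2) single)
           (simp_all add: N catastrophe_pmf_tail[OF q] N.prob_space_axioms measure_pmf.prob_space_axioms)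
      then show "emeasure (distr M (count_space UNIV) (\<tau> i)) {n} = emeasure (catastrophe_pmf q) {n}"
        by (simp add: N.emeasure_eq_measure measure_pmf.emeasure_eq_measure)
    qed auto
  qed
  have pair: "distr M (count_space UNIV) (\<lambda>\<omega>. (T0 i \<omega>, \<tau> i \<omega>))
      = measure_pmf (pair_pmf D (catastrophe_pmf q))" for i
  proof -
    have "distr M (count_space UNIV \<Otimes>\<^sub>M count_space UNIV) (\<lambda>\<omega>. (T0 i \<omega>, \<tau> i \<omega>))
        = measure_pmf D \<Otimes>\<^sub>M measure_pmf (catastrophe_pmf q)"
      using indep[of i] by (simp add: indep_var_distribution_eq T0 \<tau>)
    then have D: "distr M (count_space UNIV) (\<lambda>\<omega>. (T0 i \<omega>, \<tau> i \<omega>))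
        = measure_pmf D \<Otimes>\<^sub>M measure_pmf (catastrophe_pmf q)"
      by (simp add: pair_measure_countable)
    show ?thesis
    proof (rule measure_eqI_countable[where A = UNIV])
      fix a :: "nat \<times> nat"
      have "emeasure (measure_pmf D \<Otimes>\<^sub>M measure_pmf (catastrophe_pmf q)) ({fst a} \<times> {snd a})
          = emeasure D {fst a} * emeasure (catastrophe_pmf q) {snd a}"
        by (rule measure_pmf.emeasure_pair_measure_Times) auto
      then show "emeasure (distr M (count_space UNIV) (\<lambda>\<omega>. (T0 i \<omega>, \<tau> i \<omega>))) {a}
          = emeasure (pair_pmf D (catastrophe_pmf q)) {a}"
        by (cases a) (simp add: D emeasure_pmf_single pmf_pair ennreal_mult)
    qed auto
  qed
  have rv: "random_variable (count_space UNIV) (\<lambda>\<omega>. (T0 i \<omega>, \<tau> i \<omega>))" for i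
    using attempts_indep by (auto simp: indep_vars_def)
  show ?thesis
    using attempts_indep
    unfolding indep_vars_iff_distr_eq_PiM[OF UNIV_not_empty, where X = "\<lambda>i \<omega>. (T0 i \<omega>, \<tau> i \<omega>)"
      and M' = "\<lambda>_. count_space UNIV", OF rv]
    by (simp add: attempts_def pair restrict_def)
qed

end

theory Submission
  imports Defs
begin

text \<open>
  Conditioning on the first attempt gives a renewal equation for \<open>E[z\<^sup>T]\<close>, valid for complex
  \<open>|z| \<le> 1\<close>, whose solution is \<open>g(sz) (1 - sz) / (1 - z + q z g(sz))\<close>.  The Laplace transform of
  \<open>W\<close> is the case \<open>z = e\<^sup>-\<^sup>\<mu>\<close> with \<open>\<mu> = \<theta> p q / (1 - p)\<close>.  Put \<open>d = s g'(s) = E[T\<^sub>0 s^T\<^sub>0]\<close> and let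
  \<open>K\<close> bound \<open>n\<^sup>2 s\<^sup>n\<close>.  Then \<open>g(s e\<^sup>-\<^sup>\<mu>)\<close> lies within \<open>K \<mu>\<^sup>2\<close> of \<open>p - \<mu> d\<close>, and \<open>d\<^sup>2 \<le> K p\<close> by
  Cauchy--Schwarz, so the remainder of the first order expansion is already
  \<open>O(p \<theta>\<^sup>2 / (1 + \<theta>))\<close>: the \<open>|\<alpha>|\<^sup>2\<close> term is absorbed, and the theorem holds with constant \<open>0\<close>
  in front of it.

  For the convergence in distribution the same formula with \<open>|z| = 1\<close> gives the limit
  \<open>1 / (1 - it)\<close> of the characteristic functions.  Levy's theorem
  settles sequences of base times; a failure along a filter would produce, since only \<open>p \<rightarrow> 0\<close>
  is used, a sequence on which convergence fails.
\<close>

subsection \<open>The renewal equation\<close>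

lemma sequence_space_pmf: "sequence_space (measure_pmf M)"
  by (simp add: sequence_space_def product_prob_spaceI measure_pmf.prob_space_axioms)

lemma pair_measure_pmf:
  fixes A :: "'a::countable pmf" and B :: "'b::countable pmf"
  shows "measure_pmf A \<Otimes>\<^sub>M measure_pmf B = measure_pmf (pair_pmf A B)"
proof (rule measure_eqI_countable[where A = UNIV])
  have "sets (measure_pmf A \<Otimes>\<^sub>M measure_pmf B) = sets (count_space UNIV \<Otimes>\<^sub>M count_space UNIV)"
    by (intro sets_pair_measure_cong) auto
 also have "\<dots> = Pow UNIV"
    by (subst pair_measure_countable) auto
  finally show "sets (measure_pmf A \<Otimes>\<^sub>M measure_pmf B) = Pow UNIV" .
  fix x :: "'a \<times> 'b"
  have "emeasure (measure_pmf A \<Otimes>\<^sub>M measure_pmf B) ({fst x} \<times> {snd x})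
      = emeasure A {fst x} * emeasure B {snd x}"
    by (rule measure_pmf.emeasure_pair_measure_Times) auto
  then show "emeasure (measure_pmf A \<Otimes>\<^sub>M measure_pmf B) {x} = emeasure (pair_pmf A B) {x}"
    by (cases x) (simp add: emeasure_pmf_single pmf_pair ennreal_mult)
qed auto

lemma expectation_pair_pmf:
  fixes f :: "'a::countable \<times> 'b::countable \<Rightarrow> 'c::{banach, second_countable_topology}"
  assumes "\<And>x. norm (f x) \<le> K"
  shows "measure_pmf.expectation (pair_pmf A B) f
    = measure_pmf.expectation A (\<lambda>x. measure_pmf.expectation B (\<lambda>y. f (x, y)))"
proof -
  interpret pair_prob_space "measure_pmf A" "measure_pmf B" ..
  have "integrable (measure_pmf (pair_pmf A B)) f"
    by (rule measure_pmf.integrable_const_bound[where B = K]) (auto simp: assms)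
  then show ?thesis
    by (subst integral_fst') (simp_all add: pair_measure_pmf)
qed

lemma expectation_catastrophe_le:
  fixes z :: "'a::{real_normed_field, banach, second_countable_topology}"
  assumes q: "0 < q" "q < 1"
  shows "(1 - of_real (1 - q) * z) * measure_pmf.expectation (catastrophe_pmf q) (\<lambda>t. if n < t then 0 else z ^ t)
     = of_real q * z * (1 - (of_real (1 - q) * z) ^ n)"
proof -
  have "measure_pmf.expectation (catastrophe_pmf q) (\<lambda>t. if n < t then 0 else z ^ t)
      = (\<Sum>t<n. pmf (geometric_pmf q) t *\<^sub>R (if n < Suc t then 0 else z ^ Suc t))"
    unfolding catastrophe_pmf_def integral_map_pmf
    by (rule integral_measure_pmf) (auto split: if_splits)
  also have "\<dots> = of_real q * z * (\<Sum>t<n. (of_real (1 - q) * z) ^ t)"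
    using q by (auto simp: sum_distrib_left scaleR_conv_of_real power_mult_distrib intro!: sum.cong)
  finally show ?thesis
    by (simp add: one_diff_power_eq mult_ac)
qed

lemma expectation_catastrophe_gt:
  fixes c :: "'a::{real_normed_field, banach, second_countable_topology}"
  assumes q: "0 < q" "q < 1"
  shows "measure_pmf.expectation (catastrophe_pmf q) (\<lambda>t. if n < t then c else 0) = of_real (1 - q) ^ n * c"
proof -
  have "measure_pmf.expectation (catastrophe_pmf q) (\<lambda>t. if n < t then c else 0)
      = measure_pmf.expectation (catastrophe_pmf q) (\<lambda>t. indicator {n<..} t *\<^sub>R c)"
    by (intro Bochner_Integration.integral_cong) auto
  also have "\<dots> = measure_pmf.prob (catastrophe_pmf q) {n<..} *\<^sub>R c"
    by (subst integral_scaleR_left) (auto intro!: measure_pmf.integrable_const_bound[where B = 1])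
  also have "\<dots> = of_real (1 - q) ^ n * c"
    by (simp add: catastrophe_pmf_tail[OF q] scaleR_conv_of_real)
  finally show ?thesis .
qed

text \<open>The mean of \<open>min n \<tau>\<close> is the sum of the tails
  \<open>P(\<tau> > t) = s^t\<close> over \<open>t < n\<close>; raising \<open>n\<close> by one adds
  exactly one tail.\<close>

lemma nn_integral_min_catastrophe:
  assumes q: "0 < q" "q < 1"
  shows "(\<integral>\<^sup>+t. ennreal (real (min n t)) \<partial>catastrophe_pmf q) = ennreal ((1 - (1 - q) ^ n) / q)"
proof -
  have "(\<integral>\<^sup>+t. ennreal (real (min n t)) \<partial>catastrophe_pmf q) = ennreal (\<Sum>t<n. (1 - q) ^ t)"
  proof (induction n)
    case (Suc n)
    have "ennreal (real (min (Suc n) t)) = ennreal (real (min n t)) + indicator {n<..} t" for t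
    proof (cases "n < t")
      case True
      then have "real (min (Suc n) t) = real (min n t) + 1" by simp
      then show ?thesis using True by (simp add: ennreal_plus add.commute)
    qed auto
    then have "(\<integral>\<^sup>+t. ennreal (real (min (Suc n) t)) \<partial>catastrophe_pmf q)
        = (\<integral>\<^sup>+t. ennreal (real (min n t)) \<partial>catastrophe_pmf q) + emeasure (catastrophe_pmf q) {n<..}"
      by (simp add: nn_integral_add)
    also have "emeasure (catastrophe_pmf q) {n<..} = ennreal ((1 - q) ^ n)"
      by (simp add: measure_pmf.emeasure_eq_measure catastrophe_pmf_tail[OF q])
    finally show ?case
      using q by (simp add: Suc.IH ennreal_plus[symmetric] sum_nonneg del: ennreal_plus)
  qed simp
  then show ?thesis
    using q by (simp add: sum_gp_strict)
qed

section \<open>The i.i.d. sequence of attempts and conditioning on its first entry\<close>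

locale restarts =
  fixes q :: real and D :: "nat pmf"
  assumes q: "0 < q" "q < 1" and base: "base_time D"
begin

abbreviation "A \<equiv> pair_pmf D (catastrophe_pmf q)"

sublocale seq: sequence_space "measure_pmf A"
  by (rule sequence_space_pmf)

lemma attempts_eq: "attempts q D = Pi\<^sub>M UNIV (\<lambda>_. measure_pmf A)"
  by (simp add: attempts_def)

sublocale P: prob_space "attempts q D"
  unfolding attempts_eq by (rule seq.P.prob_space_axioms)

lemma sets_attempts [measurable_cong]:
  "sets (attempts q D) = sets (Pi\<^sub>M UNIV (\<lambda>_. count_space UNIV))"
  unfolding attempts_eq by (intro sets_PiM_cong) auto

text \<open>The random upper limit of the sum takes countably many values, so it suffices to treat
  sums with a fixed upper limit.\<close>

lemma measurable_completion_time [measurable]: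
  "completion_time \<in> measurable (attempts q D) (count_space UNIV)"
proof -
  have [measurable]: "(\<lambda>\<omega>. LEAST i. attempt_succeeds (\<omega> i)) \<in> measurable (attempts q D) (count_space UNIV)"
    by measurable
  have [measurable]: "(\<lambda>\<omega>. \<Sum>i\<le>n. attempt_length (\<omega> i)) \<in> measurable (attempts q D) (count_space UNIV)" for n :: nat
    by measurable
  show ?thesis
    unfolding completion_time_def
    by (rule measurable_compose_countable[where f = "\<lambda>n \<omega>. \<Sum>i\<le>n. attempt_length (\<omega> i)"]) measurable
qed

text \<open>Prepending an independent attempt leaves the law of the sequence unchanged. This
  self-similarity is the source of every renewal equation below.\<close>

lemma attempts_iter:
  "distr (measure_pmf A \<Otimes>\<^sub>M attempts q D) (attempts q D) (\<lambda>(a, \<omega>). case_nat a \<omega>) = attempts q D"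
  unfolding attempts_eq by (rule seq.PiM_iter)

lemma measurable_case_nat_attempts [measurable]:
  "(\<lambda>(a, \<omega>). case_nat a \<omega>) \<in> measurable (measure_pmf A \<Otimes>\<^sub>M attempts q D) (attempts q D)"
  unfolding attempts_eq by measurable

lemma nn_integral_attempts_iter:
  assumes [measurable]: "f \<in> borel_measurable (attempts q D)"
  shows "(\<integral>\<^sup>+\<omega>. f \<omega> \<partial>attempts q D) = (\<integral>\<^sup>+a. \<integral>\<^sup>+\<omega>. f (case_nat a \<omega>) \<partial>attempts q D \<partial>A)"
proof -
  have "(\<integral>\<^sup>+\<omega>. f \<omega> \<partial>attempts q D)
      = (\<integral>\<^sup>+x. f (case_nat (fst x) (snd x)) \<partial>(measure_pmf A \<Otimes>\<^sub>M attempts q D))"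
    by (subst attempts_iter[symmetric], subst nn_integral_distr) (simp_all add: case_prod_unfold)
  also have "\<dots> = (\<integral>\<^sup>+a. \<integral>\<^sup>+\<omega>. f (case_nat a \<omega>) \<partial>attempts q D \<partial>A)"
    by (subst P.nn_integral_fst[symmetric])
       (use measurable_case_nat_attempts in \<open>auto simp: case_prod_unfold intro!: measurable_compose[OF _ assms]\<close>)
  finally show ?thesis .
qed

text \<open>Fubini after \<open>attempts_iter\<close>; the bound \<open>K\<close> supplies
  integrability over the product, since all measures are probabilities.\<close>

lemma integral_attempts_iter:
  fixes f :: "(nat \<Rightarrow> nat \<times> nat) \<Rightarrow> 'b::{banach, second_countable_topology}"
  assumes [measurable]: "f \<in> borel_measurable (attempts q D)" and bd: "\<And>\<omega>. norm (f \<omega>) \<le> K"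
  shows "(LINT \<omega>|attempts q D. f \<omega>) = (LINT a|A. LINT \<omega>|attempts q D. f (case_nat a \<omega>))"
proof -
  interpret pp: pair_prob_space "measure_pmf A" "attempts q D" ..
  have m: "(\<lambda>x. f (case_nat (fst x) (snd x))) \<in> borel_measurable (measure_pmf A \<Otimes>\<^sub>M attempts q D)"
    using measurable_compose[OF measurable_case_nat_attempts assms(1)] by (simp add: case_prod_unfold)
  have "(LINT \<omega>|attempts q D. f \<omega>)
      = (LINT x|(measure_pmf A \<Otimes>\<^sub>M attempts q D). f (case_nat (fst x) (snd x)))"
    by (subst attempts_iter[symmetric], subst integral_distr) (simp_all add: case_prod_unfold)
  also have "\<dots> = (LINT a|A. LINT \<omega>|attempts q D. f (case_nat a \<omega>))"
    by (subst pp.integral_fst'[symmetric])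
       (use m bd in \<open>auto intro!: pp.P.integrable_const_bound[where B = K]\<close>)
  finally show ?thesis .
qed

text \<open>If \<open>a\<close> succeeds, the first success has index 0; otherwise it is that of
  \<open>\<omega>\<close> moved by one. The hypothesis makes the \<open>LEAST\<close> for
  \<open>\<omega>\<close> a genuine minimum.\<close>

lemma completion_time_case_nat:
  assumes "\<exists>i. attempt_succeeds (\<omega> i)"
  shows "completion_time (case_nat a \<omega>)
    = attempt_length a + (if attempt_succeeds a then 0 else completion_time \<omega>)"
proof (cases "attempt_succeeds a")
  case True
  then have "(LEAST i. attempt_succeeds (case_nat a \<omega> i)) = 0"
    by (intro Least_equality) auto
  with True show ?thesis by (simp add: completion_time_def)
next
  case False
  obtain i where i: "attempt_succeeds (\<omega> i)" using assms by blast
  have "(LEAST i. attempt_succeeds (case_nat a \<omega> i)) = Suc (LEAST i. attempt_succeeds (\<omega> i))"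
    using Least_Suc[of "\<lambda>i. attempt_succeeds (case_nat a \<omega> i)" "Suc i"] i False by simp
  with False show ?thesis by (simp add: completion_time_def sum.atMost_Suc_shift del: sum.atMost_Suc)
qed

text \<open>The complex argument lets one renewal equation serve both transforms: real
  \<open>z\<close> gives the Laplace transform, \<open>z\<close> of modulus 1 the characteristic
  function.\<close>

definition cpgf :: "complex \<Rightarrow> complex" where
  "cpgf z = (LINT n|D. z ^ n)"

abbreviation "s \<equiv> 1 - q"
abbreviation "p \<equiv> success_prob q D"

lemma cpgf_of_real: "cpgf (of_real x) = of_real (pgf D x)"
  unfolding cpgf_def pgf_def by (subst integral_complex_of_real[symmetric]) simp

lemma integrable_power [simp, intro]:
  fixes z :: "'a::{real_normed_field, banach, second_countable_topology}"
  shows "norm z \<le> 1 \<Longrightarrow> integrable (measure_pmf D) (\<lambda>n. z ^ n)"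
  by (rule measure_pmf.integrable_const_bound[where B = 1]) (auto simp: norm_power power_le_one)

section \<open>Success probability and generating functions of a single attempt\<close>

lemma success_prob_pos: "0 < p"
proof -
  obtain n where n: "n \<in> set_pmf D" using set_pmf_not_empty by fast
  have "0 < pmf D n * s ^ n" using n q by (simp add: pmf_positive)
  also have "\<dots> = (LINT k|D. indicator {n} k * s ^ n)"
    by (simp add: pmf.rep_eq)
  also have "\<dots> \<le> (LINT k|D. s ^ k)"
    using q by (intro integral_mono) (auto simp: indicator_def intro!: measure_pmf.integrable_const_bound[where B = 1] power_le_one)
  finally show ?thesis by (simp add: success_prob_def pgf_def)
qed

text \<open>The base time is at least 1, so \<open>s^k\<close> is at most \<open>s\<close> on the
  support. Consequently \<open>1 - p\<close> is at least \<open>q\<close>, which keeps all later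
  denominators \<open>1 - p\<close> away from 0 uniformly in \<open>D\<close>.\<close>

lemma success_prob_le: "p \<le> s"
proof -
  have "(LINT k|D. s ^ k) \<le> (LINT k|D. s)"
  proof (rule integral_mono_AE)
    show "AE k in D. s ^ k \<le> s"
      unfolding AE_measure_pmf_iff
    proof
      fix k assume "k \<in> set_pmf D"
      then have "1 \<le> k" using base by (cases k) (auto simp: base_time_def)
      then show "s ^ k \<le> s" using power_decreasing[of 1 k s] q by simp
    qed
  qed (use q in auto)
  then show ?thesis by (simp add: success_prob_def pgf_def)
qed

text \<open>Given base time \<open>n\<close>, success is the event \<open>\<tau> > n\<close> of
  probability \<open>s^n\<close>, and the length is then \<open>n\<close>; the average of
  \<open>(s * z)^n\<close> remains.\<close>

lemma expectation_success:
  assumes "norm z \<le> 1"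
  shows "(LINT a|A. (if attempt_succeeds a then z ^ attempt_length a else 0)) = cpgf (of_real s * z)"
proof -
  have "(LINT a|A. (if attempt_succeeds a then z ^ attempt_length a else 0))
      = (LINT n|D. LINT t|catastrophe_pmf q. (if n < t then z ^ n else 0))"
    using assms
    by (subst expectation_pair_pmf[where K = 1])
       (auto simp: norm_power power_le_one attempt_succeeds_def attempt_length_def
         intro!: Bochner_Integration.integral_cong)
  then show ?thesis
    by (simp add: expectation_catastrophe_gt[OF q] cpgf_def power_mult_distrib)
qed

lemma norm_s_mult_le: "norm (z::complex) \<le> 1 \<Longrightarrow> norm (of_real s * z) < 1"
  using q mult_left_le[of "cmod z" s] unfolding norm_mult norm_of_real by linarith

text \<open>A failing attempt has catastrophe time at most the base time, ties included, and lasts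
  exactly until the catastrophe. The truncated geometric sum is then averaged over
  \<open>D\<close>.\<close>

lemma expectation_failure:
  assumes z: "norm z \<le> 1"
  shows "(1 - of_real s * z) * (LINT a|A. (if attempt_succeeds a then 0 else z ^ attempt_length a))
    = of_real q * z * (1 - cpgf (of_real s * z))"
proof -
  have "(LINT a|A. (if attempt_succeeds a then 0 else z ^ attempt_length a))
      = (LINT n|D. LINT t|catastrophe_pmf q. (if n < t then 0 else z ^ t))"
    using assms
    by (subst expectation_pair_pmf[where K = 1])
       (auto simp: norm_power power_le_one attempt_succeeds_def attempt_length_def
         intro!: Bochner_Integration.integral_cong)
  then have "(1 - of_real s * z) * (LINT a|A. (if attempt_succeeds a then 0 else z ^ attempt_length a))
      = (LINT n|D. of_real q * z * (1 - (of_real s * z) ^ n))"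
    by (simp only: expectation_catastrophe_le[OF q, symmetric] integral_mult_right_zero)
  also have "\<dots> = of_real q * z * (1 - cpgf (of_real s * z))"
    using norm_s_mult_le[OF z]
    by (simp only: integral_mult_right_zero) (subst Bochner_Integration.integral_diff, auto simp: cpgf_def)
  finally show ?thesis .
qed

lemma prob_attempt_fails: "measure_pmf.prob A {a. \<not> attempt_succeeds a} = 1 - p"
proof -
  have "of_real (measure_pmf.prob A {a. attempt_succeeds a})
      = (LINT a|A. complex_of_real (indicator {a. attempt_succeeds a} a))"
    by simp
  also have "\<dots> = (LINT a|A. (if attempt_succeeds a then 1 ^ attempt_length a else 0))"
    by (intro Bochner_Integration.integral_cong) auto
  also have "\<dots> = of_real p"
    using expectation_success[of 1] cpgf_of_real[of s] by (simp add: success_prob_def)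
  finally have "measure_pmf.prob A {a. attempt_succeeds a} = p" by simp
  moreover have "{a. \<not> attempt_succeeds a} = UNIV - {a. attempt_succeeds a}" by auto
  ultimately show ?thesis
    using measure_pmf.prob_compl[of "{a. attempt_succeeds a}" A] by simp
qed

text \<open>Conditioning on the first attempt shows that the probability \<open>x\<close> of no
  success at all satisfies \<open>x = (1 - p) * x\<close>, and \<open>p > 0\<close> forces
  \<open>x = 0\<close>. This removes the unspecified value of \<open>LEAST\<close> from all later
  integrals.\<close>

lemma AE_attempt_succeeds: "AE \<omega> in attempts q D. \<exists>i. attempt_succeeds (\<omega> i)"
proof -
  define N where "N = {\<omega> \<in> space (attempts q D). \<not> (\<exists>i. attempt_succeeds (\<omega> i))}"
  have N [measurable]: "N \<in> sets (attempts q D)"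
    unfolding N_def by measurable
  have sp: "space (attempts q D) = UNIV"
    by (simp add: attempts_eq space_PiM)
  have "case_nat a \<omega> \<in> N \<longleftrightarrow> \<not> attempt_succeeds a \<and> \<omega> \<in> N" for a \<omega>
  proof -
    have "(\<exists>i. attempt_succeeds (case_nat a \<omega> i)) \<longleftrightarrow> attempt_succeeds a \<or> (\<exists>i. attempt_succeeds (\<omega> i))"
    proof
      assume "\<exists>i. attempt_succeeds (case_nat a \<omega> i)"
      then obtain i where "attempt_succeeds (case_nat a \<omega> i)" ..
      then show "attempt_succeeds a \<or> (\<exists>i. attempt_succeeds (\<omega> i))" by (cases i) auto
    next
      assume "attempt_succeeds a \<or> (\<exists>i. attempt_succeeds (\<omega> i))"
      then show "\<exists>i. attempt_succeeds (case_nat a \<omega> i)"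
      proof (elim disjE exE)
        assume "attempt_succeeds a"
        then show ?thesis by (intro exI[of _ 0]) simp
      next
        fix i assume "attempt_succeeds (\<omega> i)"
        then show ?thesis by (intro exI[of _ "Suc i"]) simp
      qed
    qed
    then show ?thesis unfolding N_def sp by blast
  qed
  then have ind: "indicator N (case_nat a \<omega>)
      = indicator {a. \<not> attempt_succeeds a} a * (indicator N \<omega> :: ennreal)" for a \<omega>
    by (simp add: indicator_def)
  have "emeasure (attempts q D) N = (\<integral>\<^sup>+\<omega>. indicator N \<omega> \<partial>attempts q D)" by simp
  also have "\<dots> = (\<integral>\<^sup>+a. indicator {a. \<not> attempt_succeeds a} a * emeasure (attempts q D) N \<partial>A)"
    by (subst nn_integral_attempts_iter) (simp_all add: ind nn_integral_cmult)
  also have "\<dots> = emeasure A {a. \<not> attempt_succeeds a} * emeasure (attempts q D) N"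
    by (simp add: nn_integral_multc)
  finally have "ennreal (P.prob N) = ennreal (1 - p) * ennreal (P.prob N)"
    unfolding P.emeasure_eq_measure measure_pmf.emeasure_eq_measure prob_attempt_fails .
  also have "\<dots> = ennreal ((1 - p) * P.prob N)"
    by (rule ennreal_mult''[symmetric]) simp
  finally have "P.prob N = (1 - p) * P.prob N"
    using success_prob_le q by (subst (asm) ennreal_inj) auto
  then have "p * P.prob N = 0" by (simp add: left_diff_distrib)
  then have "P.prob N = 0" using success_prob_pos by simp
  then have "N \<in> null_sets (attempts q D)"
    using N by (intro null_setsI) (simp_all add: P.emeasure_eq_measure)
  then show ?thesis
    by (rule AE_I') (auto simp: N_def)
qed

text \<open>The first attempt either ends the process or restarts it, so the transform \<phi>
  satisfies \<open>\<phi> = E[S] + E[F] * \<phi>\<close>. Multiplying by \<open>1 - s * z\<close>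
  and collecting the \<phi> terms gives the claim, since \<open>s + q = 1\<close>. Division by the
  factor of \<phi> is left to the uses, where it is shown to be nonzero.\<close>

lemma expectation_power_completion_time:
  assumes z: "norm z \<le> 1"
  defines "G \<equiv> cpgf (of_real s * z)"
  shows "(LINT \<omega>|attempts q D. z ^ completion_time \<omega>) * (1 - z + of_real q * z * G)
    = G * (1 - of_real s * z)"
proof -
  let ?\<phi> = "LINT \<omega>|attempts q D. z ^ completion_time \<omega>"
  define S where "S a = (if attempt_succeeds a then z ^ attempt_length a else 0)" for a
  define F where "F a = (if attempt_succeeds a then 0 else z ^ attempt_length a)" for a
  have bd: "norm (z ^ n) \<le> 1" for n using z by (simp add: norm_power power_le_one)
  have [measurable]: "(\<lambda>\<omega>. z ^ completion_time \<omega>) \<in> borel_measurable (attempts q D)"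
    by (rule measurable_compose[OF measurable_completion_time]) simp
  have int: "integrable (attempts q D) (\<lambda>\<omega>. z ^ completion_time \<omega>)"
    by (rule P.integrable_const_bound[where B = 1]) (auto simp: bd)
  have "?\<phi> = (LINT a|A. LINT \<omega>|attempts q D. z ^ completion_time (case_nat a \<omega>))"
    by (rule integral_attempts_iter[where K = 1]) (auto simp: bd)
  also have "\<dots> = (LINT a|A. LINT \<omega>|attempts q D. S a + F a * z ^ completion_time \<omega>)"
  proof (rule Bochner_Integration.integral_cong[OF refl], rule integral_cong_AE)
    fix a
    show "(\<lambda>\<omega>. z ^ completion_time (case_nat a \<omega>)) \<in> borel_measurable (attempts q D)"
      by (rule measurable_compose[of "\<lambda>\<omega>. case_nat a \<omega>" _ "attempts q D"]) (auto simp: attempts_eq)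
    show "AE \<omega> in attempts q D. z ^ completion_time (case_nat a \<omega>) = S a + F a * z ^ completion_time \<omega>"
      using AE_attempt_succeeds
      by eventually_elim (simp add: completion_time_case_nat S_def F_def power_add)
  qed auto
  also have "\<dots> = (LINT a|A. S a + F a * ?\<phi>)"
    using int by (simp add: P.prob_space)
  also have "\<dots> = (LINT a|A. S a) + (LINT a|A. F a) * ?\<phi>"
  proof -
    have "integrable (measure_pmf A) S" "integrable (measure_pmf A) F"
      by (auto intro!: measure_pmf.integrable_const_bound[where B = 1] simp: S_def F_def bd)
    then show ?thesis by simp
  qed
  also have "(LINT a|A. S a) = G"
    unfolding S_def G_def by (rule expectation_success[OF z])
  finally have "(1 - of_real s * z) * ?\<phi>
      = (1 - of_real s * z) * (G + (LINT a|A. F a) * ?\<phi>)"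
    by (rule arg_cong)
  then have "?\<phi> * (1 - of_real s * z) = G * (1 - of_real s * z)
      + ((1 - of_real s * z) * (LINT a|A. F a)) * ?\<phi>"
    by (simp only: distrib_left mult_ac)
  also have "(1 - of_real s * z) * (LINT a|A. F a) = of_real q * z * (1 - G)"
    unfolding F_def G_def by (rule expectation_failure[OF z])
  finally show ?thesis by (simp add: algebra_simps)
qed

section \<open>The mean completion time\<close>

lemma nn_integral_attempt_length:
  "(\<integral>\<^sup>+a. ennreal (real (attempt_length a)) \<partial>A) = ennreal ((1 - p) / q)"
proof -
  have "(\<integral>\<^sup>+a. ennreal (real (attempt_length a)) \<partial>A) = (\<integral>\<^sup>+n. ennreal ((1 - s ^ n) / q) \<partial>D)"
    by (simp add: nn_integral_pair_pmf' attempt_length_def nn_integral_min_catastrophe[OF q])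
  also have "\<dots> = ennreal (LINT n|D. (1 - s ^ n) / q)"
    using q by (intro nn_integral_eq_integral) (auto simp: power_le_one)
  also have "(LINT n|D. (1 - s ^ n) / q) = (1 - p) / q"
    using q by (simp add: success_prob_def pgf_def)
  finally show ?thesis .
qed

text \<open>The renewal equation for the mean can be solved only once the mean is known to be
  finite. Truncation at \<open>N\<close> guarantees this, and
  \<open>min N (a + b) \<le> a + min N b\<close> still yields an inequality whose solution is a
  bound independent of \<open>N\<close>.\<close>

lemma nn_integral_truncated_completion_time:
  "(\<integral>\<^sup>+\<omega>. ennreal (real (min N (completion_time \<omega>))) \<partial>attempts q D) \<le> ennreal ((1 - p) / (q * p))"
proof -
  let ?X = "\<integral>\<^sup>+\<omega>. ennreal (real (min N (completion_time \<omega>))) \<partial>attempts q D"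
  let ?F = "indicator {a. \<not> attempt_succeeds a} :: _ \<Rightarrow> ennreal"
  have "?X \<le> (\<integral>\<^sup>+\<omega>. ennreal (real N) \<partial>attempts q D)"
    by (intro nn_integral_mono) auto
  then have "?X \<noteq> \<infinity>"
    by (auto simp: P.emeasure_space_1 top_unique)
  then obtain x where x: "?X = ennreal x" "0 \<le> x" by (cases ?X) auto
  have "?X = (\<integral>\<^sup>+a. \<integral>\<^sup>+\<omega>. ennreal (real (min N (completion_time (case_nat a \<omega>)))) \<partial>attempts q D \<partial>A)"
    by (rule nn_integral_attempts_iter) simp
  also have "\<dots> \<le> (\<integral>\<^sup>+a. \<integral>\<^sup>+\<omega>. ennreal (real (attempt_length a))
      + ?F a * ennreal (real (min N (completion_time \<omega>))) \<partial>attempts q D \<partial>A)"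
  proof (rule nn_integral_mono, rule nn_integral_mono_AE)
    fix a
    show "AE \<omega> in attempts q D. ennreal (real (min N (completion_time (case_nat a \<omega>))))
       \<le> ennreal (real (attempt_length a)) + ?F a * ennreal (real (min N (completion_time \<omega>)))"
      using AE_attempt_succeeds
      by eventually_elim
        (auto simp: completion_time_case_nat indicator_def ennreal_plus[symmetric] simp del: ennreal_plus intro!: ennreal_leI)
  qed
  also have "\<dots> = ennreal ((1 - p) / q) + ennreal (1 - p) * ?X"
    by (simp add: nn_integral_add nn_integral_cmult nn_integral_multc P.emeasure_space_1
      nn_integral_attempt_length measure_pmf.emeasure_eq_measure prob_attempt_fails)
  finally have "x \<le> (1 - p) / q + (1 - p) * x"
    using x q success_prob_le by (simp add: ennreal_plus[symmetric] ennreal_mult[symmetric] del: ennreal_plus)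
  then have "x * p \<le> (1 - p) / q" by (simp add: algebra_simps)
  then have "x \<le> (1 - p) / (q * p)"
    using success_prob_pos q by (simp add: field_simps)
  then show ?thesis using x by (simp add: ennreal_leI)
qed

text \<open>Monotone convergence carries the uniform bound over to the untruncated mean. Being
  finite, the mean \<open>x\<close> is then determined by the renewal equation
  \<open>x = (1 - p) / q + (1 - p) * x\<close>.\<close>

lemma mean_completion_time: "mean_completion_time q D = (1 - p) / (q * p)"
proof -
  let ?X = "\<integral>\<^sup>+\<omega>. ennreal (real (completion_time \<omega>)) \<partial>attempts q D"
  let ?F = "indicator {a. \<not> attempt_succeeds a} :: _ \<Rightarrow> ennreal"
  have "?X = (\<integral>\<^sup>+\<omega>. (SUP N. ennreal (real (min N (completion_time \<omega>)))) \<partial>attempts q D)"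
  proof (intro nn_integral_cong antisym)
    fix \<omega>
    show "ennreal (real (completion_time \<omega>)) \<le> (SUP N. ennreal (real (min N (completion_time \<omega>))))"
      by (rule SUP_upper2[of "completion_time \<omega>"]) auto
  qed (auto intro!: SUP_least ennreal_leI)
  also have "\<dots> = (SUP N. \<integral>\<^sup>+\<omega>. ennreal (real (min N (completion_time \<omega>))) \<partial>attempts q D)"
    by (rule nn_integral_monotone_convergence_SUP)
       (auto simp: incseq_def le_fun_def intro!: ennreal_leI)
  also have "\<dots> \<le> ennreal ((1 - p) / (q * p))"
    by (intro SUP_least nn_integral_truncated_completion_time)
  finally have "?X \<noteq> \<infinity>" by (auto simp: top_unique)
  then obtain x where x: "?X = ennreal x" "0 \<le> x" by (cases ?X) auto
  have "?X = (\<integral>\<^sup>+a. \<integral>\<^sup>+\<omega>. ennreal (real (completion_time (case_nat a \<omega>))) \<partial>attempts q D \<partial>A)"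
    by (rule nn_integral_attempts_iter) simp
  also have "\<dots> = (\<integral>\<^sup>+a. \<integral>\<^sup>+\<omega>. ennreal (real (attempt_length a))
      + ?F a * ennreal (real (completion_time \<omega>)) \<partial>attempts q D \<partial>A)"
  proof (rule nn_integral_cong, rule nn_integral_cong_AE)
    fix a
    show "AE \<omega> in attempts q D. ennreal (real (completion_time (case_nat a \<omega>)))
       = ennreal (real (attempt_length a)) + ?F a * ennreal (real (completion_time \<omega>))"
      using AE_attempt_succeeds
      by eventually_elim (auto simp: completion_time_case_nat)
  qed
  also have "\<dots> = ennreal ((1 - p) / q) + ennreal (1 - p) * ?X"
    by (simp add: nn_integral_add nn_integral_cmult nn_integral_multc P.emeasure_space_1
      nn_integral_attempt_length measure_pmf.emeasure_eq_measure prob_attempt_fails)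
  finally have "x = (1 - p) / q + (1 - p) * x"
    using x q success_prob_le by (simp add: ennreal_plus[symmetric] ennreal_mult[symmetric] del: ennreal_plus)
  then have "x * p = (1 - p) / q" by (simp add: algebra_simps)
  then have "x = (1 - p) / (q * p)"
    using success_prob_pos q by (simp add: field_simps)
  then show ?thesis
    unfolding mean_completion_time_def using x by (subst integral_eq_nn_integral) auto
qed

end

subsection \<open>First order expansion of the generating function\<close>

text \<open>The quantity is the square of \<open>n * sqrt s ^ n\<close>, a null sequence and hence
  bounded. Since \<open>K\<close> depends on \<open>s\<close> only, it is what makes the later
  constants uniform in the base time; the maximum with 1 lets \<open>K\<close> absorb numerical
  constants.\<close>

lemma square_times_power_bounded:
  fixes s :: real
  assumes "0 < s" "s < 1"
  obtains K where "1 \<le> K" "\<And>n. (real n)\<^sup>2 * s ^ n \<le> K"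
proof -
  have "(\<lambda>n. real n * sqrt s ^ n) \<longlonglongrightarrow> 0"
    using assms by (intro powser_times_n_limit_0) simp
  then have "Bseq (\<lambda>n. real n * sqrt s ^ n)"
    by (intro convergent_imp_Bseq convergentI)
  then obtain L where L: "\<And>n. norm (real n * sqrt s ^ n) \<le> L"
    by (auto simp: Bseq_def)
  have "(real n)\<^sup>2 * s ^ n \<le> max 1 (L\<^sup>2)" for n
  proof -
    have "(real n)\<^sup>2 * s ^ n = (real n * sqrt s ^ n)\<^sup>2"
      using assms by (simp add: power_mult_distrib power2_eq_square mult_ac flip: real_sqrt_mult real_sqrt_power)
    also have "\<dots> \<le> L\<^sup>2"
      using L[of n] assms by (intro power_mono) (auto simp: abs_mult)
    finally show ?thesis by simp
  qed
  then show ?thesis by (intro that[of "max 1 (L\<^sup>2)"]) auto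
qed

lemma of_nat_le_square: "real n \<le> (real n)\<^sup>2"
  using le_square[of n] by (simp add: power2_eq_square flip: of_nat_mult)

text \<open>Both sides are compared with \<open>1 / (1 + x)\<close>, using
  \<open>(1 - x + x^2) * (1 + x) = 1 + x^3\<close>.\<close>

lemma exp_minus_le_quadratic:
  fixes x :: real
  assumes "0 \<le> x"
  shows "exp (- x) \<le> 1 - x + x\<^sup>2"
proof -
  have "exp (- x) \<le> 1 / (1 + x)"
    using assms exp_ge_add_one_self[of x] by (simp add: exp_minus inverse_eq_divide frac_le)
  also have "1 / (1 + x) \<le> 1 - x + x\<^sup>2"
  proof -
    have "(1 - x + x\<^sup>2) * (1 + x) = 1 + x ^ 3"
      by (simp add: algebra_simps power2_eq_square power3_eq_cube)
    then show ?thesis using assms by (simp add: divide_le_eq)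
  qed
  finally show ?thesis .
qed

section \<open>Moments of the base time weighted by \<open>s^n\<close>\<close>

context restarts
begin

definition d :: real where
  "d = (LINT n|D. real n * s ^ n)"

lemma square_times_power_integrable: "integrable (measure_pmf D) (\<lambda>n. (real n)\<^sup>2 * s ^ n)"
proof -
  obtain K where "\<And>n. (real n)\<^sup>2 * s ^ n \<le> K"
    using square_times_power_bounded[of s] q by auto
  then show ?thesis
    using q by (intro measure_pmf.integrable_const_bound[where B = K]) auto
qed

lemma times_power_integrable: "integrable (measure_pmf D) (\<lambda>n. real n * s ^ n)"
proof (rule Bochner_Integration.integrable_bound[OF square_times_power_integrable])
  show "AE n in D. norm (real n * s ^ n) \<le> norm ((real n)\<^sup>2 * s ^ n)"
    using q by (intro AE_I2) (auto simp: abs_mult power2_eq_square of_nat_le_square[unfolded power2_eq_square] intro!: mult_right_mono)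
qed simp

lemma d_nonneg: "0 \<le> d"
  using q unfolding d_def by (intro Bochner_Integration.integral_nonneg) simp

text \<open>Cauchy--Schwarz, read off from the discriminant of \<open>c \<mapsto> E[(n - c)\<^sup>2 s\<^sup>n]\<close>.\<close>

lemma d_square_le:
  assumes K: "\<And>n. (real n)\<^sup>2 * s ^ n \<le> K"
  shows "d\<^sup>2 \<le> K * p"
proof -
  let ?M = "LINT n|D. (real n)\<^sup>2 * s ^ n"
  \<comment> \<open>The minimiser of the quadratic in \<open>c\<close>.\<close>
  define c where "c = d / p"
  have "0 \<le> (LINT n|D. (real n - c)\<^sup>2 * s ^ n)"
    using q by (intro Bochner_Integration.integral_nonneg) simp
  also have "\<dots> = (LINT n|D. (real n)\<^sup>2 * s ^ n - 2 * c * (real n * s ^ n) + c\<^sup>2 * s ^ n)"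
    by (simp add: algebra_simps power2_eq_square)
  also have "\<dots> = ?M - 2 * c * d + c\<^sup>2 * p"
    using q square_times_power_integrable times_power_integrable
    by (simp add: d_def success_prob_def pgf_def)
  also have "\<dots> = ?M - d\<^sup>2 / p"
    using success_prob_pos by (simp add: c_def power2_eq_square field_simps)
  finally have "d\<^sup>2 \<le> ?M * p"
    using success_prob_pos by (simp add: field_simps)
  also have "?M \<le> (LINT n|D. K)"
    by (intro integral_mono square_times_power_integrable K) auto
  finally show ?thesis using success_prob_pos by (simp add: mult_right_mono)
qed

lemma d_le:
  assumes "\<And>n. (real n)\<^sup>2 * s ^ n \<le> K"
  shows "d \<le> K"
proof -
  have "d \<le> (LINT n|D. K)"
    unfolding d_def
  proof (rule integral_mono[OF times_power_integrable])
    fix n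
    have "real n * s ^ n \<le> (real n)\<^sup>2 * s ^ n"
      using q by (intro mult_right_mono of_nat_le_square) auto
    also note assms
    finally show "real n * s ^ n \<le> K" .
  qed simp
  then show ?thesis by simp
qed

section \<open>The generating function as a power series and its derivative\<close>

lemma expectation_sums:
  fixes f :: "nat \<Rightarrow> real"
  assumes "integrable (measure_pmf D) f"
  shows "(\<lambda>n. pmf D n * f n) sums (LINT n|D. f n)"
  using assms sums_integral_count_space_nat[of "\<lambda>n. pmf D n * f n"]
  unfolding measure_pmf_eq_density
  by (simp add: integral_density integrable_density)

lemma times_deriv_pgf: "s * deriv (pgf D) s = d"
proof -
  have pow: "(\<lambda>n. pmf D n * x ^ n) sums pgf D x" if "\<bar>x\<bar> \<le> 1" for x
    unfolding pgf_def using that by (intro expectation_sums) simp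
  have "((\<lambda>x. \<Sum>n. pmf D n * x ^ n) has_field_derivative (\<Sum>n. diffs (pmf D) n * s ^ n)) (at s)"
    using pow[of 1] q by (intro termdiffs_strong[where K = 1]) (auto simp: sums_iff)
  \<comment> \<open>The series is identified with \<open>pgf D\<close> only on the unit interval, so
    agreement is claimed near \<open>s\<close>, which is all that the derivative sees.\<close>
  moreover have "eventually (\<lambda>x. (\<Sum>n. pmf D n * x ^ n) = pgf D x) (nhds s)"
  proof -
    have "eventually (\<lambda>x. x \<in> {0<..<1}) (nhds s)"
      using q by (intro eventually_nhds_in_open) auto
    then show ?thesis
      by eventually_elim (use pow in \<open>auto simp: sums_iff\<close>)
  qed
  ultimately have "(pgf D has_field_derivative (\<Sum>n. diffs (pmf D) n * s ^ n)) (at s)"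
    by (simp add: DERIV_cong_ev)
  then have D: "deriv (pgf D) s = (\<Sum>n. diffs (pmf D) n * s ^ n)"
    by (rule DERIV_imp_deriv)
  have d: "(\<lambda>n. pmf D n * (real n * s ^ n)) sums d"
    unfolding d_def by (rule expectation_sums[OF times_power_integrable])
  \<comment> \<open>The term at \<open>n = 0\<close> vanishes, so the index can be shifted to match
    \<open>diffs\<close>.\<close>
  then have "(\<lambda>n. pmf D (Suc n) * (real (Suc n) * s ^ Suc n)) sums d"
    by (subst sums_Suc_iff) simp
  also have "(\<lambda>n. pmf D (Suc n) * (real (Suc n) * s ^ Suc n)) = (\<lambda>n. s * (diffs (pmf D) n * s ^ n))"
    by (simp add: diffs_def mult_ac)
  finally have "(\<lambda>n. s * (diffs (pmf D) n * s ^ n)) sums d" .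
  then have "(\<lambda>n. (s * (diffs (pmf D) n * s ^ n)) / s) sums (d / s)"
    by (rule sums_divide)
  then have "(\<lambda>n. diffs (pmf D) n * s ^ n) sums (d / s)"
    using q by simp
  then show ?thesis
    using D q by (simp add: sums_iff)
qed

lemma alpha_eq: "alpha q D = (s * p - q * d) / (1 - p)"
  by (simp add: alpha_def Let_def success_prob_def algebra_simps flip: times_deriv_pgf)

lemma beta_eq: "beta q D = (1 - q * p - q * d) / (1 - p)"
  by (simp add: beta_def Let_def success_prob_def algebra_simps flip: times_deriv_pgf)

lemma alpha_beta: "1 + alpha q D - beta q D = 0"
  using success_prob_le q unfolding alpha_eq beta_eq by (simp add: field_simps)

text \<open>The pointwise bounds \<open>1 - x \<le> exp (- x) \<le> 1 - x + x^2\<close> at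
  \<open>x = \<mu> * n\<close> are integrated against \<open>s^n\<close>; the quadratic term is
  controlled by \<open>K\<close>.\<close>

lemma pgf_exp_minus_bounds:
  assumes "0 \<le> \<mu>" and K: "\<And>n. (real n)\<^sup>2 * s ^ n \<le> K"
  defines "G \<equiv> pgf D (s * exp (- \<mu>))"
  shows "0 \<le> G" "G \<le> p" "p - \<mu> * d \<le> G" "G \<le> p - \<mu> * d + K * \<mu>\<^sup>2"
proof -
  have G: "G = (LINT n|D. s ^ n * exp (- (\<mu> * real n)))"
    by (simp add: G_def pgf_def power_mult_distrib mult.commute flip: exp_of_nat_mult)
  have p: "p = (LINT n|D. s ^ n)" by (simp add: success_prob_def pgf_def)
  have int: "integrable (measure_pmf D) (\<lambda>n. s ^ n * exp (- (\<mu> * real n)))"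
    using q assms by (intro measure_pmf.integrable_const_bound[where B = 1])
       (auto simp: abs_mult intro!: mult_le_one power_le_one)
  have int': "integrable (measure_pmf D) (\<lambda>n. s ^ n)" using q by simp
  have lin: "(LINT n|D. s ^ n - \<mu> * (real n * s ^ n)) = p - \<mu> * d"
    using int' times_power_integrable by (simp add: p d_def)
  show "0 \<le> G" unfolding G using q by (intro Bochner_Integration.integral_nonneg) simp
  show "G \<le> p" unfolding G p using q assms(1)
    by (intro integral_mono int int') (auto intro!: mult_left_le)
  show "p - \<mu> * d \<le> G"
    unfolding G lin[symmetric]
  proof (intro integral_mono int)
    fix n
    have "s ^ n * (1 - \<mu> * real n) \<le> s ^ n * exp (- (\<mu> * real n))"
      using q exp_ge_add_one_self[of "- (\<mu> * real n)"] by (intro mult_left_mono) auto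
    then show "s ^ n - \<mu> * (real n * s ^ n) \<le> s ^ n * exp (- (\<mu> * real n))"
      by (simp add: algebra_simps)
  qed (use int' times_power_integrable in simp)
  have "G \<le> (LINT n|D. s ^ n - \<mu> * (real n * s ^ n) + K * \<mu>\<^sup>2)"
    unfolding G
  proof (intro integral_mono int)
    fix n
    have "s ^ n * exp (- (\<mu> * real n)) \<le> s ^ n * (1 - \<mu> * real n + (\<mu> * real n)\<^sup>2)"
      using q assms(1) by (intro mult_left_mono exp_minus_le_quadratic) auto
    also have "\<dots> = s ^ n - \<mu> * (real n * s ^ n) + ((real n)\<^sup>2 * s ^ n) * \<mu>\<^sup>2"
      by (simp add: algebra_simps power_mult_distrib)
    also have "\<dots> \<le> s ^ n - \<mu> * (real n * s ^ n) + K * \<mu>\<^sup>2"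
      by (intro add_left_mono mult_right_mono K) simp
    finally show "s ^ n * exp (- (\<mu> * real n)) \<le> s ^ n - \<mu> * (real n * s ^ n) + K * \<mu>\<^sup>2" .
  qed (use int' times_power_integrable in simp)
  also have "\<dots> = p - \<mu> * d + K * \<mu>\<^sup>2"
    using int' times_power_integrable lin by simp
  finally show "G \<le> p - \<mu> * d + K * \<mu>\<^sup>2" .
qed

text \<open>For \<open>z\<close> in the closed unit disc, \<open>z^n - 1\<close> has norm at most
  \<open>n * norm (z - 1)\<close>; averaging against \<open>s^n\<close> produces
  \<open>d\<close>.\<close>

lemma norm_cpgf_diff_le:
  assumes z: "norm z \<le> 1"
  shows "norm (cpgf (of_real s * z) - of_real p) \<le> norm (z - 1) * d"
proof -
  have "cpgf (of_real s * z) - of_real p = (LINT n|D. (of_real s * z) ^ n - of_real (s ^ n))"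
    using norm_s_mult_le[OF z] q cpgf_of_real[of s]
    by (subst Bochner_Integration.integral_diff)
       (auto simp: cpgf_def success_prob_def simp del: of_real_diff intro!: measure_pmf.integrable_const_bound[where B = 1] power_le_one)
  also have "norm \<dots> \<le> (LINT n|D. norm (z - 1) * (real n * s ^ n))"
  proof (rule order_trans[OF integral_norm_bound integral_mono])
    show "integrable (measure_pmf D) (\<lambda>n. norm (z - 1) * (real n * s ^ n))"
      using times_power_integrable by simp
    show "integrable (measure_pmf D) (\<lambda>n. norm ((of_real s * z) ^ n - complex_of_real (s ^ n)))"
      using norm_s_mult_le[OF z] q
      by (intro integrable_norm Bochner_Integration.integrable_diff)
         (auto simp del: of_real_diff intro!: measure_pmf.integrable_const_bound[where B = 1] power_le_one)
    fix n
    have "(of_real s * z) ^ n - complex_of_real (s ^ n) = of_real (s ^ n) * (z ^ n - 1 ^ n)"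
      by (simp only: power_mult_distrib of_real_power power_one right_diff_distrib mult_1_right)
    also have "norm \<dots> \<le> s ^ n * (real n * norm (z - 1))"
      unfolding norm_mult norm_of_real using q z norm_power_diff[of z 1 n]
      by (intro mult_mono) auto
    finally show "norm ((of_real s * z) ^ n - complex_of_real (s ^ n)) \<le> norm (z - 1) * (real n * s ^ n)"
      by (simp add: mult_ac)
  qed
  also have "\<dots> = norm (z - 1) * d" by (simp add: d_def)
  finally show ?thesis .
qed

end

subsection \<open>The Laplace transform\<close>

text \<open>The analytic core, stated for bare real numbers: \<open>G\<close> stands for the
  generating function at \<open>s * exp (- \<mu>)\<close> and \<phi> for the Laplace transform. The
  numerator of \<open>\<phi> - 1 / (1 + \<theta>)\<close> over \<open>X * c\<close> is
  \<open>N - q * \<mu>^2 * d\<close>. Then \<open>T1\<close> bounds the \<open>N\<close> part,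
  \<open>T2\<close> matches the other part with the \<open>d\<close> term of the coefficient alpha,
  and \<open>T3\<close> puts the remaining \<open>(1 - q) * p\<close> term of alpha into the
  error.\<close>

lemma laplace_expansion_bound:
  fixes q K p d G \<theta> \<phi> \<mu> :: real
  assumes q: "0 < q" "q < 1" and K: "1 \<le> K" and p: "0 < p" "p \<le> 1 - q"
    and d: "0 \<le> d" "d \<le> K" "d\<^sup>2 \<le> K * p" and \<theta>: "0 < \<theta>"
    and \<mu>_def: "\<mu> = \<theta> * p * q / (1 - p)" and \<mu>_le: "\<mu> \<le> 1"
    and G: "0 \<le> G" "G \<le> p" "p - \<mu> * d \<le> G" "G \<le> p - \<mu> * d + K * \<mu>\<^sup>2"
    and \<phi>: "\<phi> * (exp \<mu> - 1 + q * G) = G * (exp \<mu> - 1 + q)"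
  shows "\<bar>\<phi> - 1 / (1 + \<theta>) - ((1 - q) * p - q * d) / (1 - p) * \<theta>\<^sup>2 / (1 + \<theta>)\<^sup>2\<bar>
    \<le> (6 * K\<^sup>2 / q\<^sup>2 + 2 * K\<^sup>2 / q ^ 3 + 1 / q) * (p * \<theta>\<^sup>2 / (1 + \<theta>))"
proof -
  define a where "a = 1 - p"
  define E where "E = exp \<mu> - 1"
  define r where "r = E - \<mu>"
  define \<delta> where "\<delta> = p - G"
  define X where "X = E + q * G"
  \<comment> \<open>This gives \<open>1 / (1 + \<theta>) = q * p / c\<close>, and \<open>c\<close>
    is the leading part of \<open>a * X\<close>, as \<open>aXc\<close> below makes precise.\<close>
  define c where "c = q * p * (1 + \<theta>)"
  define m where "m = q / (2 * K)"
  define B where "B = p * \<theta>\<^sup>2 / (1 + \<theta>)"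
  have a: "q \<le> a" "a \<le> 1" "0 < a" using p q by (auto simp: a_def)
  have m: "0 < m" using q K by (simp add: m_def)
  have \<mu>a: "\<mu> * a = \<theta> * q * p" using a by (simp add: \<mu>_def a_def[symmetric] mult_ac)
  have \<mu>pos: "0 < \<mu>" using \<theta> p q a by (simp add: \<mu>_def a_def[symmetric])
  have \<mu>p: "\<mu> \<le> \<theta> * p"
  proof -
    have "\<theta> * p * q \<le> \<theta> * p * a" using a p \<theta> by (intro mult_left_mono) auto
    then show ?thesis using a by (simp add: \<mu>_def a_def[symmetric] divide_le_eq)
  qed
  have \<mu>ge: "\<theta> * p * q \<le> \<mu>"
    using mult_left_le[of a \<mu>] a \<mu>pos \<mu>a by (simp add: mult_ac)
  have c: "c = q * p + \<mu> * a" by (simp add: c_def \<mu>a algebra_simps)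
  have cpos: "0 < c" using q p \<theta> by (simp add: c_def)
  have r: "0 \<le> r" "r \<le> \<mu>\<^sup>2"
    using exp_ge_add_one_self[of \<mu>] exp_bound[of \<mu>] \<mu>pos \<mu>_le unfolding r_def E_def by linarith+
  have "\<mu>\<^sup>2 \<le> \<mu>" using \<mu>pos \<mu>_le by (simp add: power2_eq_square mult_left_le)
  then have E: "\<mu> \<le> E" "E \<le> 2 * \<mu>" using r by (auto simp: r_def)
  have \<delta>: "0 \<le> \<delta>" "\<delta> \<le> \<mu> * d" "\<mu> * d - \<delta> \<le> K * \<mu>\<^sup>2" using G by (auto simp: \<delta>_def)
  \<comment> \<open>The lower bound \<open>p - \<mu> * d\<close> for \<open>G\<close> may be
    negative. Only the fraction \<open>1 / (2 * K)\<close> of \<open>G\<close> is used, so that the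
    loss is at most \<open>\<mu> / 2\<close>; the term \<open>E \<ge> \<mu>\<close> pays for it and
    leaves another \<open>\<mu> / 2\<close> for the part proportional to \<theta>.\<close>
  have X: "m * p * (1 + \<theta>) \<le> X"
  proof -
    have "G / (2 * K) \<le> G / 1" using G K by (intro divide_left_mono) auto
    then have "G / (2 * K) \<le> G" by simp
    moreover have "(p - \<mu> * K) / (2 * K) \<le> G / (2 * K)"
    proof (rule divide_right_mono)
      have "\<mu> * d \<le> \<mu> * K" using d \<mu>pos by simp
      then show "p - \<mu> * K \<le> G" using G by simp
    qed (use K in simp)
    ultimately have "(p - \<mu> * K) / (2 * K) \<le> G" by simp
    then have "q * ((p - \<mu> * K) / (2 * K)) \<le> q * G" by (rule mult_left_mono) (use q in simp)
    moreover have "q * ((p - \<mu> * K) / (2 * K)) = m * p - q * \<mu> / 2"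
      using K by (simp add: m_def field_simps)
    moreover have "q * \<mu> \<le> \<mu>" using q \<mu>pos by simp
    ultimately have "m * p + \<mu> / 2 \<le> X" using E by (simp add: X_def)
    moreover have "m * p * \<theta> \<le> \<mu> / 2"
    proof -
      have "m \<le> q / 2" using K q by (simp add: m_def field_simps)
      then have "m * (p * \<theta>) \<le> q / 2 * (p * \<theta>)" using p \<theta> by (intro mult_right_mono) auto
      then show ?thesis using \<mu>ge by (simp add: mult_ac)
    qed
    ultimately show ?thesis by (simp add: algebra_simps)
  qed
  have mp: "0 < m * p * (1 + \<theta>)" using m p \<theta> by simp
  then have Xpos: "0 < X" using X by simp
  have Xc: "m * q * p\<^sup>2 * (1 + \<theta>)\<^sup>2 \<le> X * c"
  proof -
    have "m * p * (1 + \<theta>) * c \<le> X * c" using X cpos by (intro mult_right_mono) auto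
    then show ?thesis by (simp add: c_def power2_eq_square mult_ac)
  qed
  \<comment> \<open>What is left of the numerator once \<open>q * \<mu>^2 * d\<close> is split off.
    Its three summands come from the curvature of \<open>G\<close>, the curvature of
    \<open>exp\<close>, and the product of first order terms.\<close>
  define N where "N = q * \<mu> * (\<mu> * d - \<delta>) - q * p * r * (1 - G) + G * E * \<mu> * a"
  have "\<phi> = G * (E + q) / X"
    using \<phi> Xpos by (simp add: E_def X_def field_simps)
  moreover have "1 / (1 + \<theta>) = q * p / c" using q p by (simp add: c_def)
  ultimately have "\<phi> - 1 / (1 + \<theta>) = (G * (E + q) * c - q * p * X) / (X * c)"
    using Xpos cpos by (simp add: diff_frac_eq)
  also have "G * (E + q) * c - q * p * X = N - q * \<mu>\<^sup>2 * d"
    unfolding c N_def X_def \<delta>_def r_def a_def by algebra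
  finally have main: "\<phi> - 1 / (1 + \<theta>) = N / (X * c) - q * \<mu>\<^sup>2 * d / (X * c)"
    by (simp add: diff_divide_distrib)

  have T1: "\<bar>N / (X * c)\<bar> \<le> 3 * K / (m * q) * B"
  proof -
    have "\<bar>N\<bar> \<le> \<bar>q * \<mu> * (\<mu> * d - \<delta>)\<bar> + \<bar>q * p * r * (1 - G)\<bar> + \<bar>G * E * \<mu> * a\<bar>"
      unfolding N_def by linarith
    also have "\<bar>q * \<mu> * (\<mu> * d - \<delta>)\<bar> \<le> 1 * (\<theta> * p) * (K * \<mu>\<^sup>2)"
      unfolding abs_mult using q \<mu>pos \<mu>p \<delta> by (intro mult_mono) auto
    also have "\<bar>q * p * r * (1 - G)\<bar> \<le> 1 * p * \<mu>\<^sup>2 * 1"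
      unfolding abs_mult using q p r G by (intro mult_mono) auto
    also have "\<bar>G * E * \<mu> * a\<bar> \<le> p * (2 * \<mu>) * \<mu> * 1"
      unfolding abs_mult using G E a \<mu>pos by (intro mult_mono) auto
    finally have "\<bar>N\<bar> \<le> p * \<mu>\<^sup>2 * (K * \<theta> + 3)"
      by (simp add: algebra_simps power2_eq_square)
    also have "\<dots> \<le> p * (\<theta> * p)\<^sup>2 * (3 * K * (1 + \<theta>))"
    proof (intro mult_mono power_mono)
      have "0 \<le> K * \<theta>" using K \<theta> by simp
      then show "K * \<theta> + 3 \<le> 3 * K * (1 + \<theta>)" using K by (simp add: algebra_simps)
    qed (use p K \<theta> \<mu>pos \<mu>p in auto)
    finally have N: "\<bar>N\<bar> \<le> p * (\<theta> * p)\<^sup>2 * (3 * K * (1 + \<theta>))" .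
    have "\<bar>N / (X * c)\<bar> = \<bar>N\<bar> / (X * c)" using Xpos cpos by (simp add: abs_divide abs_mult)
    also have "\<dots> \<le> (p * (\<theta> * p)\<^sup>2 * (3 * K * (1 + \<theta>))) / (m * q * p\<^sup>2 * (1 + \<theta>)\<^sup>2)"
      using N Xc m q p \<theta> K by (intro frac_le) auto
    also have "\<dots> = 3 * K / (m * q) * B"
      using m q p \<theta> by (simp add: B_def divide_simps) (simp add: power2_eq_square algebra_simps)
    finally show ?thesis .
  qed

  \<comment> \<open>Since \<open>\<mu> * a = \<theta> * q * p\<close>, the two terms would coincide
    if \<open>a * X\<close> were equal to \<open>c\<close>; their difference carries the factor
    \<open>d * (a * X - c)\<close>.\<close>
  have T2: "\<bar>q * d / a * \<theta>\<^sup>2 / (1 + \<theta>)\<^sup>2 - q * \<mu>\<^sup>2 * d / (X * c)\<bar> \<le> K / (q\<^sup>2 * m) * B"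
  proof -
    have e: "q * \<mu>\<^sup>2 * d / (X * c) = q * d * (\<theta> * q * p)\<^sup>2 / (a\<^sup>2 * (X * c))"
      unfolding \<mu>a[symmetric] using a by (simp add: power_mult_distrib)
    have eq: "q * d / a * \<theta>\<^sup>2 / (1 + \<theta>)\<^sup>2 - q * \<mu>\<^sup>2 * d / (X * c)
        = q * \<theta>\<^sup>2 * (d * (a * X - c)) / (a\<^sup>2 * (1 + \<theta>)\<^sup>2 * X)"
      unfolding e unfolding c_def using a Xpos q p \<theta>
      by (simp add: divide_simps) (simp add: power2_eq_square algebra_simps)
    have aXc: "a * X - c = a * r - a * q * \<delta> - q * p\<^sup>2"
      unfolding c X_def r_def \<delta>_def a_def by algebra
    have "\<bar>a * X - c\<bar> \<le> \<bar>a * r\<bar> + \<bar>a * q * \<delta>\<bar> + \<bar>q * p\<^sup>2\<bar>"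
      unfolding aXc by linarith
    also have "\<bar>a * r\<bar> \<le> 1 * \<mu>\<^sup>2"
      unfolding abs_mult using a r by (intro mult_mono) auto
    also have "\<bar>a * q * \<delta>\<bar> \<le> 1 * 1 * (\<mu> * d)"
      unfolding abs_mult using a q \<delta> by (intro mult_mono) auto
    also have "\<bar>q * p\<^sup>2\<bar> \<le> 1 * p\<^sup>2"
      unfolding abs_mult using q by (intro mult_mono) auto
    finally have "\<bar>a * X - c\<bar> \<le> \<mu>\<^sup>2 + \<mu> * d + p\<^sup>2" by simp
    then have "\<bar>d * (a * X - c)\<bar> \<le> d * (\<mu>\<^sup>2 + \<mu> * d + p\<^sup>2)"
      using d by (simp add: abs_mult mult_left_mono)
    also have "\<dots> = d * \<mu>\<^sup>2 + \<mu> * d\<^sup>2 + d * p\<^sup>2"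
      by (simp add: algebra_simps power2_eq_square)
    \<comment> \<open>The bound \<open>d^2 \<le> K * p\<close> is decisive in the middle term:
      \<open>d \<le> K\<close> alone would leave it one power of \<open>p\<close> short.\<close>
    also have "\<dots> \<le> K * (\<theta> * p)\<^sup>2 + (\<theta> * p) * (K * p) + K * p\<^sup>2"
      using d \<mu>pos \<mu>p p \<theta> K by (intro add_mono mult_mono power_mono) auto
    also have "\<dots> \<le> K * p\<^sup>2 * (1 + \<theta>)\<^sup>2"
      using K p \<theta> by (simp add: algebra_simps power2_eq_square)
    finally have num: "\<bar>d * (a * X - c)\<bar> \<le> K * p\<^sup>2 * (1 + \<theta>)\<^sup>2" .
    have "\<bar>q * \<theta>\<^sup>2 * (d * (a * X - c)) / (a\<^sup>2 * (1 + \<theta>)\<^sup>2 * X)\<bar>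
        = q * \<theta>\<^sup>2 * \<bar>d * (a * X - c)\<bar> / (a\<^sup>2 * (1 + \<theta>)\<^sup>2 * X)"
      using q a Xpos by (simp add: abs_mult)
    also have "\<dots> \<le> 1 * \<theta>\<^sup>2 * (K * p\<^sup>2 * (1 + \<theta>)\<^sup>2) / (q\<^sup>2 * (1 + \<theta>)\<^sup>2 * (m * p * (1 + \<theta>)))"
      using num q a X mp \<theta> p K by (intro frac_le mult_mono power_mono) auto
    also have "\<dots> = K / (q\<^sup>2 * m) * B"
      using m q p \<theta> by (simp add: B_def divide_simps) (simp add: power2_eq_square algebra_simps)
    finally show ?thesis unfolding eq .
  qed

  have T3: "\<bar>(1 - q) * p / a * \<theta>\<^sup>2 / (1 + \<theta>)\<^sup>2\<bar> \<le> 1 / q * B"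
  proof -
    have "\<bar>(1 - q) * p / a * \<theta>\<^sup>2 / (1 + \<theta>)\<^sup>2\<bar> = (1 - q) * p * \<theta>\<^sup>2 / (a * (1 + \<theta>)\<^sup>2)"
      using q a p \<theta> by (simp add: abs_mult)
    also have "\<dots> \<le> 1 * p * \<theta>\<^sup>2 / (q * (1 + \<theta>))"
      using q a p \<theta> by (intro frac_le mult_mono) (auto simp: power2_eq_square)
    finally show ?thesis by (simp add: B_def)
  qed

  have "\<phi> - 1 / (1 + \<theta>) - ((1 - q) * p - q * d) / (1 - p) * \<theta>\<^sup>2 / (1 + \<theta>)\<^sup>2
      = N / (X * c) + (q * d / a * \<theta>\<^sup>2 / (1 + \<theta>)\<^sup>2 - q * \<mu>\<^sup>2 * d / (X * c))
        - (1 - q) * p / a * \<theta>\<^sup>2 / (1 + \<theta>)\<^sup>2"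
    unfolding main a_def by (simp add: diff_divide_distrib left_diff_distrib)
  also have "\<bar>\<dots>\<bar> \<le> 3 * K / (m * q) * B + K / (q\<^sup>2 * m) * B + 1 / q * B"
    using T1 T2 T3 by linarith
  also have "\<dots> = (6 * K\<^sup>2 / q\<^sup>2 + 2 * K\<^sup>2 / q ^ 3 + 1 / q) * B"
    using q K by (simp add: m_def power2_eq_square power3_eq_cube algebra_simps)
  finally show ?thesis unfolding B_def .
qed

section \<open>The Laplace transform of the normalised completion time\<close>

context restarts
begin

lemma success_prob_less_1: "p < 1"
  using success_prob_le q by simp

lemma W_eq: "W q D \<omega> = p * q / (1 - p) * real (completion_time \<omega>)"
  by (simp add: W_def mean_completion_time mult_ac)

lemma measurable_W [measurable]: "W q D \<in> borel_measurable (attempts q D)"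
  unfolding W_eq by measurable

text \<open>The integrand is \<open>z ^ completion_time \<omega>\<close> with
  \<open>z = exp (- \<mu>)\<close>. Multiplying the renewal equation by \<open>exp \<mu>\<close>
  clears the negative exponentials and turns \<open>1 - s * z\<close> into
  \<open>exp \<mu> - 1 + q\<close>.\<close>

lemma laplace_W:
  assumes "0 < \<theta>"
  defines "\<mu> \<equiv> \<theta> * p * q / (1 - p)"
  defines "G \<equiv> pgf D (s * exp (- \<mu>))"
  shows "(LINT \<omega>|attempts q D. exp (- \<theta> * W q D \<omega>)) * (exp \<mu> - 1 + q * G)
    = G * (exp \<mu> - 1 + q)"
proof -
  let ?\<phi> = "LINT \<omega>|attempts q D. exp (- \<theta> * W q D \<omega>)"
  have \<mu>: "0 \<le> \<mu>"
    using assms q success_prob_pos success_prob_less_1 by (simp add: \<mu>_def)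
  have "complex_of_real ?\<phi> = (LINT \<omega>|attempts q D. complex_of_real (exp (- \<theta> * W q D \<omega>)))"
    by (rule integral_complex_of_real[symmetric])
  also have "\<dots> = (LINT \<omega>|attempts q D. complex_of_real (exp (- \<mu>)) ^ completion_time \<omega>)"
    by (intro Bochner_Integration.integral_cong refl)
       (simp add: W_eq \<mu>_def mult_ac flip: of_real_power exp_of_nat_mult)
  finally have "complex_of_real ?\<phi> * (1 - of_real (exp (- \<mu>)) + of_real q * of_real (exp (- \<mu>)) * of_real G)
      = of_real G * (1 - of_real s * of_real (exp (- \<mu>)))"
    using expectation_power_completion_time[of "complex_of_real (exp (- \<mu>))"] \<mu>
    by (simp add: G_def flip: cpgf_of_real)
  then have "complex_of_real (?\<phi> * (1 - exp (- \<mu>) + q * exp (- \<mu>) * G))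
      = complex_of_real (G * (1 - s * exp (- \<mu>)))"
    by simp
  then have "?\<phi> * (1 - exp (- \<mu>) + q * exp (- \<mu>) * G) = G * (1 - s * exp (- \<mu>))"
    by (simp only: of_real_eq_iff)
  then have "exp \<mu> * (?\<phi> * (1 - exp (- \<mu>) + q * exp (- \<mu>) * G)) = exp \<mu> * (G * (1 - s * exp (- \<mu>)))"
    by (rule arg_cong)
  moreover have "exp \<mu> * exp (- \<mu>) = 1" by (simp flip: exp_add)
  ultimately show ?thesis by algebra
qed

end

lemma laplace_W_expansion:
  assumes q: "0 < q" "q < 1"
  obtains C where "\<And>D \<theta>. base_time D \<Longrightarrow> 0 < \<theta> \<Longrightarrow>
      \<theta> * success_prob q D * q / (1 - success_prob q D) \<le> 1 \<Longrightarrow>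
      \<bar>(LINT \<omega>|attempts q D. exp (- \<theta> * W q D \<omega>)) - 1 / (1 + \<theta>)
          - alpha q D * \<theta>\<^sup>2 / (1 + \<theta>)\<^sup>2\<bar> \<le> C * (success_prob q D * \<theta>\<^sup>2 / (1 + \<theta>))"
proof -
  \<comment> \<open>Chosen before \<open>D\<close> and \<theta>, so that the resulting constant
    depends on \<open>q\<close> only.\<close>
  obtain K where K: "1 \<le> K" "\<And>n. (real n)\<^sup>2 * (1 - q) ^ n \<le> K"
    using square_times_power_bounded[of "1 - q"] q by auto
  show ?thesis
  proof (rule that)
    fix D \<theta>
    assume D: "base_time D" and \<theta>: "0 < \<theta>"
      and le: "\<theta> * success_prob q D * q / (1 - success_prob q D) \<le> 1"
    interpret restarts q D using q D by unfold_locales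
    define \<mu> where "\<mu> = \<theta> * p * q / (1 - p)"
    have \<mu>: "0 \<le> \<mu>"
      using \<theta> q success_prob_pos success_prob_less_1 by (simp add: \<mu>_def)
    note G = pgf_exp_minus_bounds[OF \<mu> K(2)]
    show "\<bar>(LINT \<omega>|attempts q D. exp (- \<theta> * W q D \<omega>)) - 1 / (1 + \<theta>)
          - alpha q D * \<theta>\<^sup>2 / (1 + \<theta>)\<^sup>2\<bar>
        \<le> (6 * K\<^sup>2 / q\<^sup>2 + 2 * K\<^sup>2 / q ^ 3 + 1 / q) * (p * \<theta>\<^sup>2 / (1 + \<theta>))"
      unfolding alpha_eq
      by (rule laplace_expansion_bound[OF q K(1) success_prob_pos success_prob_le d_nonneg
            d_le[OF K(2)] d_square_le[OF K(2)] \<theta> \<mu>_def le[folded \<mu>_def] G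
            laplace_W[OF \<theta>, folded \<mu>_def]])
  qed
qed

subsection \<open>Convergence in distribution\<close>

text \<open>The integrand is \<open>exp (x * w)\<close> with \<open>w = \<i> * t - 1\<close>. Its
  antiderivative \<open>exp (x * w) / w\<close> vanishes at infinity because \<open>w\<close> has
  real part -1.\<close>

lemma char_exponential:
  "char (density lborel (exponential_density 1)) t = 1 / (1 - \<i> * of_real t)"
proof -
  define w where "w = \<i> * complex_of_real t - 1"
  define f where "f x = exp (of_real x * w)" for x :: real
  have w: "w \<noteq> 0" by (auto simp: w_def complex_eq_iff)
  have nf: "norm (f x) = exp (- x)" for x
    by (simp add: f_def w_def norm_exp_eq_Re)
  have "integrable lborel (exponential_density 1)"
    using prob_space_exponential_density[of 1]
    by (intro integrableI_nonneg) (auto simp: exponential_density_nonneg prob_space.emeasure_space_1 emeasure_density dest!: prob_space.emeasure_space_1)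
  then have int: "set_integrable lborel {0<..} f"
    unfolding set_integrable_def
    by (rule Bochner_Integration.integrable_bound)
       (auto simp: nf exponential_density_def indicator_def, simp add: f_def)
  have "(LBINT x=0..\<infinity>. f x) = 0 - 1 / w"
  proof (rule interval_integral_FTC_integrable)
    show "((\<lambda>x. f x / w) has_vector_derivative f x) (at x)" for x
      unfolding f_def using w
      by (intro has_vector_derivative_real_field[where f = "\<lambda>x. exp (x * w) / w"])
         (auto intro!: derivative_eq_intros)
    show "isCont f x" for x unfolding f_def by (intro continuous_intros)
    show "set_integrable lborel (einterval 0 \<infinity>) f"
      using int by (simp add: zero_ereal_def)
    show "(((\<lambda>x. f x / w) \<circ> real_of_ereal) \<longlongrightarrow> 1 / w) (at_right 0)"
    proof -
      have "isCont (\<lambda>x. f x / w) 0" unfolding f_def using w by (intro continuous_intros)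
      then have "((\<lambda>x. f x / w) \<longlongrightarrow> 1 / w) (at_right 0)"
        by (auto simp: isCont_def f_def intro: filterlim_at_split[THEN iffD1, THEN conjunct2] tendsto_within_subset)
      then show ?thesis by (simp add: zero_ereal_def ereal_tendsto_simps)
    qed
    have "((\<lambda>x. f x / w) \<longlongrightarrow> 0) at_top"
    proof (rule tendsto_norm_zero_cancel)
      have "((\<lambda>x::real. exp (- x) / norm w) \<longlongrightarrow> 0 / norm w) at_top"
        by (intro tendsto_intros filterlim_compose[OF exp_at_bot] filterlim_uminus_at_bot_at_top) (use w in auto)
      then show "((\<lambda>x. norm (f x / w)) \<longlongrightarrow> 0) at_top" by (simp add: norm_divide nf)
    qed
    then show "(((\<lambda>x. f x / w) \<circ> real_of_ereal) \<longlongrightarrow> 0) (at_left \<infinity>)"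
      by (simp add: ereal_tendsto_simps)
  qed simp
  then have "(LINT x:{0<..}|lborel. f x) = 1 / (1 - \<i> * of_real t)"
    using w by (simp add: interval_lebesgue_integral_def zero_ereal_def w_def field_simps)
  moreover have "char (density lborel (exponential_density 1)) t = (LINT x:{0<..}|lborel. f x)"
    unfolding char_def set_lebesgue_integral_def
  proof (subst integral_density)
    show "(LINT x|lborel. exponential_density 1 x *\<^sub>R iexp (t * x)) = (LINT x|lborel. indicator {0<..} x *\<^sub>R f x)"
    proof (rule integral_cong_AE)
      \<comment> \<open>The density is 1 at 0 whereas the indicator of the open half-line is 0
        there, hence equality only off the null set \<open>{0}\<close>.\<close>
      show "AE x in lborel. exponential_density 1 x *\<^sub>R iexp (t * x) = indicator {0<..} x *\<^sub>R f x"
        using AE_lborel_singleton[of 0]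
        by eventually_elim
           (auto simp: exponential_density_def f_def w_def indicator_def scaleR_conv_of_real algebra_simps exp_add exp_diff exp_minus exp_of_real[symmetric] divide_inverse)
    qed (auto simp: f_def)
  qed (auto simp: exponential_density_nonneg)
  ultimately show ?thesis by simp
qed

context restarts
begin

text \<open>The renewal equation is divided by \<open>p\<close>: the factor of the characteristic
  function degenerates as \<open>p\<close> tends to 0, whereas its quotient by \<open>p\<close> has
  a nonzero limit.\<close>

lemma char_W:
  fixes t :: real
  defines "z \<equiv> iexp (t * (p * q / (1 - p)))"
  shows "char (distr (attempts q D) borel (W q D)) t * ((1 - z) / of_real p + of_real q * z * (cpgf (of_real s * z) / of_real p))
    = cpgf (of_real s * z) / of_real p * (1 - of_real s * z)"
proof -
  have z: "norm z \<le> 1" by (simp add: z_def)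
  have "char (distr (attempts q D) borel (W q D)) t = (LINT \<omega>|attempts q D. iexp (t * W q D \<omega>))"
    unfolding char_def by (subst integral_distr) auto
  also have "\<dots> = (LINT \<omega>|attempts q D. z ^ completion_time \<omega>)"
    by (intro Bochner_Integration.integral_cong refl)
       (simp add: W_eq z_def mult_ac flip: exp_of_nat_mult)
  finally have eq: "char (distr (attempts q D) borel (W q D)) t * (1 - z + of_real q * z * cpgf (of_real s * z))
      = cpgf (of_real s * z) * (1 - of_real s * z)"
    using expectation_power_completion_time[OF z] by simp
  have "char (distr (attempts q D) borel (W q D)) t * ((1 - z) / of_real p + of_real q * z * (cpgf (of_real s * z) / of_real p))
      = (char (distr (attempts q D) borel (W q D)) t * (1 - z + of_real q * z * cpgf (of_real s * z))) / of_real p"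
    by (simp only: times_divide_eq_right flip: add_divide_distrib)
  then show ?thesis
    unfolding eq by (simp only: times_divide_eq_left)
qed

end

text \<open>With \<open>z\<close> near 1, the quotient \<open>(1 - z) / p\<close> tends to
  \<open>- \<i> * t * q\<close> and \<open>g\<close> tends to 1. The denominator \<open>X\<close>
  thus tends to \<open>q * (1 - \<i> * t)\<close> and the numerator to \<open>q\<close>.\<close>

lemma tendsto_char_W:
  fixes D :: "nat \<Rightarrow> nat pmf"
  assumes q: "0 < q" "q < 1" and D: "\<And>n. base_time (D n)"
    and p0: "(\<lambda>n. success_prob q (D n)) \<longlonglongrightarrow> 0"
  shows "(\<lambda>n. char (distr (attempts q (D n)) borel (W q (D n))) t) \<longlonglongrightarrow> 1 / (1 - \<i> * of_real t)"
proof -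
  interpret restarts q "D n" for n using q D by unfold_locales
  let ?p = "\<lambda>n. success_prob q (D n)"
  let ?\<phi> = "\<lambda>n. char (distr (attempts q (D n)) borel (W q (D n))) t"
  \<comment> \<open>The argument \<open>t / E[T]\<close> is written as \<open>v * p\<close>, where
    \<open>v\<close> stays bounded.\<close>
  define v where "v n = t * (q / (1 - ?p n))" for n
  define z where "z n = iexp (v n * ?p n)" for n
  define g where "g n = cpgf n (of_real (1 - q) * z n) / of_real (?p n)" for n
  obtain K where K: "\<And>n. (real n)\<^sup>2 * (1 - q) ^ n \<le> K"
    using square_times_power_bounded[of "1 - q"] q by auto
  have v: "v \<longlonglongrightarrow> t * q"
    unfolding v_def by (rule tendsto_eq_intros p0 refl | simp)+
  have vp: "(\<lambda>n. v n * ?p n) \<longlonglongrightarrow> 0"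
    using tendsto_mult[OF v p0] by simp
  have "isCont iexp 0" by (rule isCont_iexp)
  from isCont_tendsto_compose[OF this vp] have z: "z \<longlonglongrightarrow> 1"
    unfolding z_def[abs_def] by simp
  have z1: "(\<lambda>n. (1 - z n) / of_real (?p n)) \<longlonglongrightarrow> - (\<i> * of_real (t * q))"
  proof -
    have "(\<lambda>n. (1 - z n) / of_real (?p n) + \<i> * of_real (v n)) \<longlonglongrightarrow> 0"
    proof (rule Lim_null_comparison)
      have "norm ((1 - z n) / of_real (?p n) + \<i> * of_real (v n)) \<le> (v n)\<^sup>2 * ?p n" for n
      proof -
        have pos: "0 < ?p n" by (rule success_prob_pos)
        then have "(1 - z n) / of_real (?p n) + \<i> * of_real (v n)
            = - (iexp (v n * ?p n) - (1 + \<i> * of_real (v n * ?p n))) / of_real (?p n)"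
          by (simp add: z_def field_simps)
        also have "norm \<dots> = norm (iexp (v n * ?p n) - (1 + \<i> * of_real (v n * ?p n))) / ?p n"
          using pos by (simp add: norm_divide norm_minus_commute)
        also have "\<dots> \<le> (v n * ?p n)\<^sup>2 / ?p n"
        proof (rule divide_right_mono)
          have "norm (iexp (v n * ?p n) - (1 + \<i> * of_real (v n * ?p n))) \<le> \<bar>v n * ?p n\<bar>\<^sup>2 / 2"
            using iexp_approx1[of "v n * ?p n" 1] by (simp add: numeral_2_eq_2)
          also have "\<dots> \<le> (v n * ?p n)\<^sup>2" by simp
          finally show "norm (iexp (v n * ?p n) - (1 + \<i> * of_real (v n * ?p n))) \<le> (v n * ?p n)\<^sup>2" .
        qed (use pos in simp)
        also have "\<dots> = (v n)\<^sup>2 * ?p n" using pos by (simp add: power2_eq_square)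
        finally show ?thesis .
      qed
      then show "\<forall>\<^sub>F n in sequentially. norm ((1 - z n) / of_real (?p n) + \<i> * of_real (v n)) \<le> (v n)\<^sup>2 * ?p n"
        by simp
      show "(\<lambda>n. (v n)\<^sup>2 * ?p n) \<longlonglongrightarrow> 0"
        using tendsto_mult[OF tendsto_power[OF v, of 2] p0] by simp
    qed
    from tendsto_diff[OF this tendsto_mult[OF tendsto_const[of "\<i>"] tendsto_of_real[OF v]]]
    show ?thesis by simp
  qed
  \<comment> \<open>Here \<open>norm (z - 1)\<close> is at most \<open>\<bar>v\<bar> * p\<close> and
    Cauchy--Schwarz bounds \<open>d\<close> by \<open>sqrt (K * p)\<close>; after division by
    \<open>p\<close> an error of order \<open>sqrt p\<close> remains.\<close>
  have g: "g \<longlonglongrightarrow> 1"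
  proof (rule LIM_zero_cancel, rule Lim_null_comparison)
    have "norm (g n - 1) \<le> \<bar>v n\<bar> * sqrt (K * ?p n)" for n
    proof -
      have pos: "0 < ?p n" by (rule success_prob_pos)
      have "norm (z n - 1) \<le> \<bar>v n * ?p n\<bar>"
        using iexp_approx1[of "v n * ?p n" 0] by (simp add: z_def)
      moreover have "d n \<le> sqrt (K * ?p n)"
        using d_square_le[OF K] by (rule real_le_rsqrt)
      ultimately have "norm (z n - 1) * d n \<le> \<bar>v n * ?p n\<bar> * sqrt (K * ?p n)"
        using d_nonneg by (intro mult_mono) auto
      moreover have "norm (cpgf n (of_real (1 - q) * z n) - of_real (?p n)) \<le> norm (z n - 1) * d n"
        by (rule norm_cpgf_diff_le) (simp add: z_def)
      ultimately have "norm (cpgf n (of_real (1 - q) * z n) - of_real (?p n)) / ?p n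
          \<le> (\<bar>v n * ?p n\<bar> * sqrt (K * ?p n)) / ?p n"
        using pos by (intro divide_right_mono) auto
      moreover have "g n - 1 = (cpgf n (of_real (1 - q) * z n) - of_real (?p n)) / of_real (?p n)"
        using pos by (simp add: g_def diff_divide_distrib)
      ultimately show ?thesis using pos by (simp add: norm_divide abs_mult)
    qed
    then show "\<forall>\<^sub>F n in sequentially. norm (g n - 1) \<le> \<bar>v n\<bar> * sqrt (K * ?p n)"
      by simp
    have "(\<lambda>n. \<bar>v n\<bar> * sqrt (K * ?p n)) \<longlonglongrightarrow> \<bar>t * q\<bar> * sqrt (K * 0)"
      by (intro tendsto_intros v p0)
    then show "(\<lambda>n. \<bar>v n\<bar> * sqrt (K * ?p n)) \<longlonglongrightarrow> 0" by simp
  qed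
  define X where "X n = (1 - z n) / of_real (?p n) + of_real q * z n * g n" for n
  define L where "L = of_real q * (1 - \<i> * of_real t)"
  have X: "X \<longlonglongrightarrow> L"
    using tendsto_add[OF z1 tendsto_mult[OF tendsto_mult[OF tendsto_const[of "of_real q"] z] g]]
    unfolding X_def[abs_def] L_def by (simp add: algebra_simps)
  have L: "L \<noteq> 0" using q by (auto simp: L_def complex_eq_iff)
  have eq: "?\<phi> n * X n = g n * (1 - of_real (1 - q) * z n)" for n
    using char_W[of n t] by (simp add: X_def g_def z_def v_def mult_ac)
  have "(\<lambda>n. g n * (1 - of_real (1 - q) * z n) / X n) \<longlonglongrightarrow> 1 * (1 - of_real (1 - q) * 1) / L"
    by (intro tendsto_intros g z X L)
  also have "1 * (1 - of_real (1 - q) * 1) / L = 1 / (1 - \<i> * of_real t)"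
    using q by (simp add: L_def)
  finally show ?thesis
  proof (rule Lim_transform_eventually)
    show "\<forall>\<^sub>F n in sequentially. g n * (1 - of_real (1 - q) * z n) / X n = ?\<phi> n"
      using tendsto_imp_eventually_ne[OF X L]
      by eventually_elim (simp del: of_real_diff flip: eq)
  qed
qed

lemma weak_conv_m_W:
  fixes D :: "nat \<Rightarrow> nat pmf"
  assumes q: "0 < q" "q < 1" and D: "\<And>n. base_time (D n)"
    and p0: "(\<lambda>n. success_prob q (D n)) \<longlonglongrightarrow> 0"
  shows "weak_conv_m (\<lambda>n. distr (attempts q (D n)) borel (W q (D n)))
    (density lborel (exponential_density 1))"
proof (rule levy_continuity)
  interpret restarts q "D n" for n using q D by unfold_locales
  show "real_distribution (distr (attempts q (D n)) borel (W q (D n)))" for n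
    by (intro P.real_distribution_distr) measurable
  show "real_distribution (density lborel (exponential_density 1))"
    by (simp add: real_distribution_def real_distribution_axioms_def prob_space_exponential_density)
  show "(\<lambda>n. char (distr (attempts q (D n)) borel (W q (D n))) t)
      \<longlonglongrightarrow> char (density lborel (exponential_density 1)) t" for t
    unfolding char_exponential by (rule tendsto_char_W[OF q D p0])
qed

text \<open>The sequential statement is upgraded to a uniform one: for each continuity point and
  each \<open>e\<close> some \<delta> exists such that \<open>success_prob q D < \<delta>\<close>
  alone forces closeness of the distribution functions. Otherwise counterexamples for
  \<open>\<delta> = 1 / (n + 1)\<close> would form a sequence contradicting
  \<open>weak_conv_m_W\<close>. The uniform form then applies along any filter.\<close>

lemma weak_conv_along_W:
  fixes D :: "'i \<Rightarrow> nat pmf"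
  assumes q: "0 < q" "q < 1" and D: "\<And>i. base_time (D i)"
    and p0: "((\<lambda>i. success_prob q (D i)) \<longlongrightarrow> 0) F"
  shows "weak_conv_along (\<lambda>i. distr (attempts q (D i)) borel (W q (D i)))
    (density lborel (exponential_density 1)) F"
  unfolding weak_conv_along_def
proof (intro allI impI tendstoI)
  fix x e :: real
  let ?cdf = "\<lambda>D. cdf (distr (attempts q D) borel (W q D)) x"
  let ?l = "cdf (density lborel (exponential_density 1)) x"
  assume x: "isCont (cdf (density lborel (exponential_density 1))) x" and e: "0 < e"
  have "\<exists>\<delta>>0. \<forall>D. base_time D \<longrightarrow> success_prob q D < \<delta> \<longrightarrow> dist (?cdf D) ?l < e"
  proof (rule ccontr)
    assume "\<not> ?thesis"
    then have "\<exists>D. base_time D \<and> success_prob q D < \<delta> \<and> \<not> dist (?cdf D) ?l < e" if "0 < \<delta>" for \<delta>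
      using that by blast
    then have "\<exists>D. base_time D \<and> success_prob q D < inverse (real (Suc n)) \<and> \<not> dist (?cdf D) ?l < e" for n
      by simp
    then obtain E where E: "\<And>n. base_time (E n)" "\<And>n. success_prob q (E n) < inverse (real (Suc n))"
        "\<And>n. \<not> dist (?cdf (E n)) ?l < e"
      by metis
    have "(\<lambda>n. success_prob q (E n)) \<longlonglongrightarrow> 0"
    proof (rule tendsto_sandwich[OF _ _ tendsto_const LIMSEQ_inverse_real_of_nat])
      have "0 \<le> success_prob q (E n)" for n
        using restarts.success_prob_pos[of q "E n"] q E(1) by (simp add: restarts_def less_imp_le)
      then show "\<forall>\<^sub>F n in sequentially. 0 \<le> success_prob q (E n)" by simp
    qed (use E(2) in \<open>simp add: less_imp_le\<close>)
    then have "(\<lambda>n. ?cdf (E n)) \<longlonglongrightarrow> ?l"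
      using weak_conv_m_W[OF q E(1)] x by (simp add: weak_conv_m_def weak_conv_def)
    then have "\<forall>\<^sub>F n in sequentially. dist (?cdf (E n)) ?l < e" using e by (rule tendstoD)
    then show False using E(3) by simp
  qed
  then obtain \<delta> where \<delta>: "0 < \<delta>"
      "\<And>D. base_time D \<Longrightarrow> success_prob q D < \<delta> \<Longrightarrow> dist (?cdf D) ?l < e"
    by blast
  have "\<forall>\<^sub>F i in F. success_prob q (D i) < \<delta>"
    using p0 \<delta>(1) by (rule order_tendstoD)
  then show "\<forall>\<^sub>F i in F. dist (?cdf (D i)) ?l < e"
    by eventually_elim (rule \<delta>(2)[OF D])
qed

theorem theorem1p3:
  fixes q :: real
  assumes "0 < q" and "q < 1"
  shows
    "(\<forall>D. base_time D \<longrightarrow> 1 + alpha q D - beta q D = 0) \<and>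
     (\<exists>p0>0. \<exists>\<epsilon>0>0. \<exists>C1 C2. \<forall>D \<theta>.
        base_time D \<and> success_prob q D \<le> p0 \<and> \<theta> > 0 \<and>
        \<theta> * success_prob q D * q / (1 - success_prob q D) \<le> \<epsilon>0 \<longrightarrow>
        \<bar>(LINT \<omega>|attempts q D. exp (- \<theta> * W q D \<omega>)) - 1 / (1 + \<theta>)
            - alpha q D * \<theta>\<^sup>2 / (1 + \<theta>)\<^sup>2\<bar>
          \<le> C1 * (\<bar>alpha q D\<bar>\<^sup>2 * \<theta> ^ 3 / (1 + \<theta>) ^ 3)
            + C2 * (success_prob q D * \<theta>\<^sup>2 / (1 + \<theta>))) \<and>
     (\<forall>(D :: 'i \<Rightarrow> nat pmf) F.
        (\<forall>i. base_time (D i)) \<and> ((\<lambda>i. success_prob q (D i)) \<longlongrightarrow> 0) F \<longrightarrow>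
        weak_conv_along (\<lambda>i. distr (attempts q (D i)) borel (W q (D i)))
          (density lborel (exponential_density 1)) F)"
proof (intro conjI allI impI)
  show "1 + alpha q D - beta q D = 0" if "base_time D" for D
    using assms that by (intro restarts.alpha_beta restarts.intro)
  obtain C where "\<And>D \<theta>. base_time D \<Longrightarrow> 0 < \<theta> \<Longrightarrow>
      \<theta> * success_prob q D * q / (1 - success_prob q D) \<le> 1 \<Longrightarrow>
      \<bar>(LINT \<omega>|attempts q D. exp (- \<theta> * W q D \<omega>)) - 1 / (1 + \<theta>)
          - alpha q D * \<theta>\<^sup>2 / (1 + \<theta>)\<^sup>2\<bar> \<le> C * (success_prob q D * \<theta>\<^sup>2 / (1 + \<theta>))"
    using laplace_W_expansion[OF assms] by blast
  then show "\<exists>p0>0. \<exists>\<epsilon>0>0. \<exists>C1 C2. \<forall>D \<theta>.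
        base_time D \<and> success_prob q D \<le> p0 \<and> \<theta> > 0 \<and>
        \<theta> * success_prob q D * q / (1 - success_prob q D) \<le> \<epsilon>0 \<longrightarrow>
        \<bar>(LINT \<omega>|attempts q D. exp (- \<theta> * W q D \<omega>)) - 1 / (1 + \<theta>)
            - alpha q D * \<theta>\<^sup>2 / (1 + \<theta>)\<^sup>2\<bar>
          \<le> C1 * (\<bar>alpha q D\<bar>\<^sup>2 * \<theta> ^ 3 / (1 + \<theta>) ^ 3)
            + C2 * (success_prob q D * \<theta>\<^sup>2 / (1 + \<theta>))"
    \<comment> \<open>Both thresholds are 1, that for \<epsilon>0 being the one of the expansion;
      \<open>C1\<close> is 0 because the \<open>C2\<close> term already bounds the
      remainder.\<close>
    by (intro exI[of _ 1] conjI exI[of _ "0::real"] exI[of _ C]) auto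
  show "weak_conv_along (\<lambda>i. distr (attempts q (D i)) borel (W q (D i)))
      (density lborel (exponential_density 1)) F"
    if "(\<forall>i. base_time (D i)) \<and> ((\<lambda>i. success_prob q (D i)) \<longlongrightarrow> 0) F"
    for D :: "'i \<Rightarrow> nat pmf" and F
    using that by (intro weak_conv_along_W[OF assms]) auto
qed

end
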